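(* In the biclustering setup below, suppose $\Sigma_0=W_1DW_2^T$ is a singular value decomposition with $W_1\in\mathbb{O}(p_1,r)$, $W_2\in\mathbb{O}(p_2,r)$, $D=\mathrm{diag}(\sigma_1(\Sigma_0),\dots,\sigma_r(\Sigma_0))$, put $\Sigma_{01}=W_1D^{1/2}$, $\Sigma_{02}=W_2D^{1/2}$, and assume there is a constant $\delta>0$ with $\min_{s_1\ne s_2}\|[\Sigma_{01}]_{s_1*}-[\Sigma_{01}]_{s_2*}\|_2\ge\delta$ and $\min_{t_1\ne t_2}\|[\Sigma_{02}]_{t_1*}-[\Sigma_{02}]_{t_2*}\|_2\ge\delta$. If $\log m=o(\sqrt n)$ and $\log n=o(\sqrt m)$, then the spectral clustering estimates $\hat\tau,\hat\gamma$ are strongly consistent: there exist permutations $\omega_m$ of $[p_1]$ and $\iota_n$ of $[p_2]$ with $$\mathbb{P}_0\{d_H(\hat\tau,\omega_m\circ\tau_0)=0,\ d_H(\hat\gamma,\iota_n\circ\gamma_0)=0\}\to1\qquad(\min(m,n)\to\infty).$$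
   Context: Biclustering setup: fixed integers $p_1,p_2$ and $r\le\min(p_1,p_2)$; $\Sigma_0\in\mathbb{R}^{p_1\times p_2}$ with $\mathrm{rank}(\Sigma_0)=r$; cluster maps $\tau_0:[m]\to[p_1]$, $\gamma_0:[n]\to[p_2]$ with $\frac1m\#\{i:\tau_0(i)=s\}\to w_s>0$ and $\frac1n\#\{j:\gamma_0(j)=t\}\to\pi_t>0$. Observed $Y\in\mathbb{R}^{m\times n}$, $Y=Y_0^*+E$ with $[Y_0^*]_{ij}=[\Sigma_0]_{\tau_0(i)\gamma_0(j)}$ and the entries of $E$ i.i.d. mean-zero sub-Gaussian with variance $\sigma^2>0$. $\mathbb{O}(a,r)$ = $a\times r$ matrices with orthonormal columns; $[B]_{i*}$ denotes the $i$th row; $d_H(\tau_1,\tau_2)=\#\{i:\tau_1(i)\ne\tau_2(i)\}$. Spectral clustering: $\hat U\in\mathbb{O}(m,r)$, $\hat V\in\mathbb{O}(n,r)$ are leading singular vector matrices of $Y$ ($Y\hat V=\hat U\,\mathrm{diag}(\sigma_1(Y),\dots,\sigma_r(Y))$). $C(\hat U)\in\arg\min\{\|C-\hat U\|_F:C\in\mathbb{R}^{m\times r}\text{ with }p_1\text{ distinct rows}\}$ and $C(\hat V)\in\arg\min\{\|C-\hat V\|_F:C\in\mathbb{R}^{n\times r}\text{ with }p_2\text{ distinct rows}\}$ ($K$-means); $\hat\tau:[m]\to[p_1]$ is any map with $\hat\tau(i_1)=\hat\tau(i_2)$ iff $[C(\hat U)]_{i_1*}=[C(\hat U)]_{i_2*}$,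 and $\hat\gamma$ is defined likewise from $C(\hat V)$.
   Formalization: The permutations are allowed to depend on the realization (they stand inside the event): as the labels of the estimates are arbitrary and may depend on the data, no fixed permutations could work; K-means is taken over matrices with at most p₁ (resp. p₂) distinct rows. *)

theory Defs
  imports "HOL-Probability.Probability" "HOL-Library.Landau_Symbols"
begin

text \<open>Matrices of varying size are represented as functions nat => nat => real,
 only entries with indices below the stated dimensions being meaningful.\<close>

definition orthonormal_cols :: "nat \<Rightarrow> nat \<Rightarrow> (nat \<Rightarrow> nat \<Rightarrow> real) \<Rightarrow> bool" where
  "orthonormal_cols a r W \<longleftrightarrow>
     (\<forall>k<r. \<forall>l<r. (\<Sum>i<a. W i k * W i l) = (if k = l then 1 else 0))"

definition thin_svd :: "nat \<Rightarrow> nat \<Rightarrow> (nat \<Rightarrow> nat \<Rightarrow> real) \<Rightarrow>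
     (nat \<Rightarrow> nat \<Rightarrow> real) \<Rightarrow> (nat \<Rightarrow> real) \<Rightarrow> (nat \<Rightarrow> nat \<Rightarrow> real) \<Rightarrow> bool" where
  "thin_svd a b Y U s V \<longleftrightarrow>
     orthonormal_cols a (min a b) U \<and> orthonormal_cols b (min a b) V \<and>
     (\<forall>k<min a b. 0 \<le> s k) \<and>
     (\<forall>k1 k2. k1 \<le> k2 \<longrightarrow> k2 < min a b \<longrightarrow> s k2 \<le> s k1) \<and>
     (\<forall>i<a. \<forall>j<b. Y i j = (\<Sum>k<min a b. s k * U i k * V j k))"

definition leading_sv :: "nat \<Rightarrow> nat \<Rightarrow> nat \<Rightarrow> (nat \<Rightarrow> nat \<Rightarrow> real) \<Rightarrow>
     (nat \<Rightarrow> nat \<Rightarrow> real) \<Rightarrow> (nat \<Rightarrow> nat \<Rightarrow> real) \<Rightarrow> bool" where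
  "leading_sv a b r Y Uh Vh \<longleftrightarrow> r \<le> min a b \<and>
     (\<exists>U s V. thin_svd a b Y U s V \<and>
        (\<forall>i<a. \<forall>k<r. Uh i k = U i k) \<and> (\<forall>j<b. \<forall>k<r. Vh j k = V j k))"

definition mrow :: "nat \<Rightarrow> (nat \<Rightarrow> nat \<Rightarrow> real) \<Rightarrow> nat \<Rightarrow> real list" where
  "mrow r C i = map (C i) [0..<r]"

definition frob_dist2 :: "nat \<Rightarrow> nat \<Rightarrow> (nat \<Rightarrow> nat \<Rightarrow> real) \<Rightarrow> (nat \<Rightarrow> nat \<Rightarrow> real) \<Rightarrow> real" where
  "frob_dist2 a r C U = (\<Sum>i<a. \<Sum>k<r. (C i k - U i k)\<^sup>2)"

definition few_rows :: "nat \<Rightarrow> nat \<Rightarrow> nat \<Rightarrow> (nat \<Rightarrow> nat \<Rightarrow> real) \<Rightarrow> bool" where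
  "few_rows a r p C \<longleftrightarrow> card (mrow r C ` {..<a}) \<le> p"

definition kmeans_sol :: "nat \<Rightarrow> nat \<Rightarrow> nat \<Rightarrow> (nat \<Rightarrow> nat \<Rightarrow> real) \<Rightarrow> (nat \<Rightarrow> nat \<Rightarrow> real) \<Rightarrow> bool" where
  "kmeans_sol a r p U C \<longleftrightarrow> few_rows a r p C \<and>
     (\<forall>C'. few_rows a r p C' \<longrightarrow> frob_dist2 a r C U \<le> frob_dist2 a r C' U)"

definition labeling :: "nat \<Rightarrow> nat \<Rightarrow> nat \<Rightarrow> (nat \<Rightarrow> nat \<Rightarrow> real) \<Rightarrow> (nat \<Rightarrow> nat) \<Rightarrow> bool" where
  "labeling a r p C tau \<longleftrightarrow> (\<forall>i<a. tau i < p) \<and>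
     (\<forall>i1<a. \<forall>i2<a. tau i1 = tau i2 \<longleftrightarrow> mrow r C i1 = mrow r C i2)"

definition hamming :: "nat \<Rightarrow> (nat \<Rightarrow> nat) \<Rightarrow> (nat \<Rightarrow> nat) \<Rightarrow> nat" where
  "hamming a t1 t2 = card {i. i < a \<and> t1 i \<noteq> t2 i}"

definition subgaussian :: "real measure \<Rightarrow> bool" where
  "subgaussian \<mu> \<longleftrightarrow> (\<exists>c>0. \<forall>t::real. integrable \<mu> (\<lambda>x. exp (t * x)) \<and>
      (\<integral>x. exp (t * x) \<partial>\<mu>) \<le> exp (c * t\<^sup>2))"

end

(* The i-th row of the left singular matrix is Y_i V / s, where Y_i is the i-th row of Y. Its signal
   part depends on i only through the cluster tau0(i), so the rows are perturbations of exact cluster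
   centres by E_i V / s, and no rotation has to be aligned. Substituting s V = Y^T U turns E_i V into
   a combination of E_i Y0^T U, governed by sums of E over clusters, and E_i E^T U, at most
   |E_i| |E|_op in norm. The operator norm comes from |E|_op^4 <= |E E^T|_F^2, whose expectation is
   O(m n (m + n)); as the entries are at most a multiple of sqrt(ln (m n)), the rates make both parts
   negligible against the separation of the centres, which is of order m^(-1/2). Weyl-type bounds for
   the singular values follow from dimension counts. Optimality in K-means then forces each row to
   its own centre. The right singular matrix is treated by transposition. *)

theory Submission
  imports Defs "HOL-Real_Asymp.Real_Asymp"
begin

text \<open>The obstacle is that V depends on all of the noise, so row i of E V is not a sum of
  independent terms and no tail bound applies to it directly. All probability is therefore put into
  one event about E alone (\<open>tame_noise\<close>). On it the argument is deterministic and
  covers every choice of singular vectors, K-means minimisers and labels at once, so the estimates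
  need not be measurable. The rates come from the threshold B for the operator norm. With L bounding
  the entries, each coordinate of E_i E^T U is at most B sqrt(n) L and has to stay below \<epsilon>
  n sqrt(m), which suggests B = \<epsilon> sqrt(m n) / L. Markov's inequality at B^4 then leaves a
  failure probability of order L^4 (1/m + 1/n) / \<epsilon>^4, and since L^2 is of order ln(m n),
  the two rates are what makes it vanish. \<epsilon> is a fixed constant: the perturbation of the
  rows and the separation of the centres are both of order m^(-1/2), and only their ratio
  matters.\<close>

abbreviation (input) vnorm :: "nat \<Rightarrow> (nat \<Rightarrow> real) \<Rightarrow> real" where
  "vnorm a x \<equiv> L2_set x {..<a}"

text \<open>The form x^T A y. It stands in for the operator norm: the bound
  \<open>\<bar>bil a b x E y\<bar> \<le> B * vnorm a x * vnorm b y\<close> for all x and y expresses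
  that E has operator norm at most B.\<close>

definition bil :: "nat \<Rightarrow> nat \<Rightarrow> (nat \<Rightarrow> real) \<Rightarrow> (nat \<Rightarrow> nat \<Rightarrow> real) \<Rightarrow> (nat \<Rightarrow> real) \<Rightarrow> real" where
  "bil a b x A y = (\<Sum>i<a. \<Sum>j<b. x i * A i j * y j)"

section \<open>Cauchy-Schwarz estimates\<close>

lemma L2_set_squared: "(L2_set f A)\<^sup>2 = (\<Sum>i\<in>A. (f i)\<^sup>2)"
  by (simp add: L2_set_def sum_nonneg)

lemma sum_mult_le_L2_set: "\<bar>\<Sum>i\<in>A. f i * g i\<bar> \<le> L2_set f A * L2_set g A"
  by (rule order_trans[OF sum_abs]) (simp add: abs_mult L2_set_mult_ineq)

text \<open>Meant for s the singular values on a block K of indices, f and g the coordinates of two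
  test vectors in the singular bases, and t a bound for the block.\<close>

lemma weighted_sum_mult_le:
  assumes "\<And>k. k \<in> K \<Longrightarrow> 0 \<le> s k \<and> s k \<le> t"
  shows "\<bar>\<Sum>k\<in>K. s k * f k * g k\<bar> \<le> t * L2_set f K * L2_set g K"
\<comment> \<open>For empty K nothing forces t to be nonnegative, which the monotonicity below
  needs.\<close>
proof (cases "K = {}")
  case False
  then have t: "0 \<le> t" using assms by force
  have "\<bar>\<Sum>k\<in>K. s k * f k * g k\<bar> \<le> (\<Sum>k\<in>K. t * (\<bar>f k\<bar> * \<bar>g k\<bar>))"
    by (rule order_trans[OF sum_abs], rule sum_mono)
      (use assms in \<open>auto simp: abs_mult mult.assoc intro!: mult_right_mono\<close>)
  also have "\<dots> = t * (\<Sum>k\<in>K. \<bar>f k\<bar> * \<bar>g k\<bar>)"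
    by (simp add: sum_distrib_left)
  also have "\<dots> \<le> t * (L2_set f K * L2_set g K)"
    by (intro mult_left_mono L2_set_mult_ineq t)
  finally show ?thesis by (simp add: mult.assoc)
qed simp

subsection \<open>Singular value bounds\<close>

text \<open>Gaussian elimination by induction on the number of equations: a nontrivial last equation
  determines one unknown p, and substituting it leaves k equations in the other unknowns, of which
  there are still more than k.\<close>

lemma underdetermined_system:
  fixes a :: "nat \<Rightarrow> 'b \<Rightarrow> real"
  assumes "finite I" "k < card I"
  shows "\<exists>c. (\<exists>l\<in>I. c l \<noteq> 0) \<and> (\<forall>i<k. (\<Sum>l\<in>I. c l * a i l) = 0)"
  using assms
proof (induction k arbitrary: I a)
  case 0
  then obtain l where "l \<in> I" by fastforce
  then show ?case by (intro exI[of _ "\<lambda>_. 1"]) auto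
next
  case (Suc k)
  show ?case
  proof (cases "\<forall>l\<in>I. a k l = 0")
    case True
    obtain c where c: "\<exists>l\<in>I. c l \<noteq> 0" "\<forall>i<k. (\<Sum>l\<in>I. c l * a i l) = 0"
      using Suc.IH[of I a] Suc.prems by auto
    have "(\<Sum>l\<in>I. c l * a k l) = 0" using True by simp
    then show ?thesis using c by (auto simp: less_Suc_eq intro!: exI[of _ c])
  next
    case False
    then obtain p where p: "p \<in> I" "a k p \<noteq> 0" by blast
    let ?I = "I - {p}"
    have "k < card ?I" using Suc.prems p by simp
    then obtain c where c: "\<exists>l\<in>?I. c l \<noteq> 0"
      "\<forall>i<k. (\<Sum>l\<in>?I. c l * (a i l - a i p * a k l / a k p)) = 0"
      using Suc.IH[of ?I "\<lambda>i l. a i l - a i p * a k l / a k p"] Suc.prems by auto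
    \<comment> \<open>The value at p is the one that makes equation k hold; in the other equations
      it reproduces the elimination terms.\<close>
    let ?e = "c(p := - (\<Sum>l\<in>?I. c l * a k l) / a k p)"
    have split: "(\<Sum>l\<in>I. ?e l * b l) = (\<Sum>l\<in>?I. c l * b l) + ?e p * b p" for b :: "'b \<Rightarrow> real"
      using Suc.prems p by (subst sum.remove[of I p]) (auto intro!: sum.cong)
    have "(\<Sum>l\<in>I. ?e l * a i l) = 0" if "i < Suc k" for i
    proof (cases "i = k")
      case True
      then show ?thesis unfolding split using p by simp
    next
      case False
      then have "(\<Sum>l\<in>?I. c l * (a i l - a i p * a k l / a k p)) = 0" using c that by simp
      moreover have "(\<Sum>l\<in>?I. c l * (a i l - a i p * a k l / a k p))
          = (\<Sum>l\<in>?I. c l * a i l) - (\<Sum>l\<in>?I. c l * a k l) / a k p * a i p"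
        by (simp add: algebra_simps sum_subtractf sum_distrib_left sum_divide_distrib)
      ultimately show ?thesis unfolding split by simp
    qed
    moreover have "\<exists>l\<in>I. ?e l \<noteq> 0" using c by auto
    ultimately show ?thesis by blast
  qed
qed

lemma orthonormal_cols_coeff:
  assumes "orthonormal_cols a q U" "K \<subseteq> {..<q}" "k < q"
  shows "(\<Sum>i<a. (\<Sum>l\<in>K. c l * U i l) * U i k) = (if k \<in> K then c k else 0)"
proof -
  have fin: "finite K" using assms finite_subset by blast
  have "(\<Sum>i<a. (\<Sum>l\<in>K. c l * U i l) * U i k) = (\<Sum>l\<in>K. c l * (\<Sum>i<a. U i l * U i k))"
    by (simp add: sum_distrib_right sum_distrib_left mult.assoc) (rule sum.swap)
  also have "\<dots> = (\<Sum>l\<in>K. if l = k then c l else 0)"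
    using assms unfolding orthonormal_cols_def by (intro sum.cong) auto
  finally show ?thesis using fin by simp
qed

lemma orthonormal_cols_norm:
  assumes "orthonormal_cols a q U" "K \<subseteq> {..<q}"
  shows "vnorm a (\<lambda>i. \<Sum>l\<in>K. c l * U i l) = L2_set c K"
proof -
  have "(\<Sum>i<a. (\<Sum>l\<in>K. c l * U i l)\<^sup>2)
      = (\<Sum>k\<in>K. c k * (\<Sum>i<a. (\<Sum>l\<in>K. c l * U i l) * U i k))"
    unfolding power2_eq_square
    by (simp add: sum_distrib_left sum_distrib_right mult_ac) (subst sum.swap, simp add: mult_ac)
  also have "\<dots> = (\<Sum>k\<in>K. (c k)\<^sup>2)"
    using orthonormal_cols_coeff[OF assms] assms(2)
    by (intro sum.cong) (auto simp: power2_eq_square)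
  finally show ?thesis by (simp add: L2_set_def)
qed

text \<open>No completion to a basis is involved: the squared norm of the coefficient vector c is
  the inner product of x with its projection, whose norm is again that of c, so Cauchy-Schwarz gives
  |c|^2 \<le> |x| |c|.\<close>

lemma orthonormal_cols_bessel:
  assumes "orthonormal_cols a q U" "K \<subseteq> {..<q}"
  shows "L2_set (\<lambda>k. \<Sum>i<a. x i * U i k) K \<le> vnorm a x"
proof -
  define c where "c = (\<lambda>k. \<Sum>i<a. x i * U i k)"
  have c: "z * c l = (\<Sum>i<a. x i * (z * U i l))" for z l
    unfolding c_def sum_distrib_left by (intro sum.cong refl mult.left_commute)
  have "(L2_set c K)\<^sup>2 = (\<Sum>l\<in>K. \<Sum>i<a. x i * (c l * U i l))"
    unfolding L2_set_squared by (intro sum.cong refl) (simp only: power2_eq_square, rule c)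
  also have "\<dots> = (\<Sum>i<a. x i * (\<Sum>l\<in>K. c l * U i l))"
    unfolding sum_distrib_left by (rule sum.swap)
  also have "\<dots> \<le> vnorm a x * vnorm a (\<lambda>i. \<Sum>l\<in>K. c l * U i l)"
    by (rule abs_le_D1[OF sum_mult_le_L2_set])
  also have "\<dots> = vnorm a x * L2_set c K"
    using orthonormal_cols_norm[OF assms] by simp
  finally have "L2_set c K * L2_set c K \<le> vnorm a x * L2_set c K" by (simp add: power2_eq_square)
  then have "L2_set c K \<le> vnorm a x"
    using L2_set_nonneg[of c K] L2_set_nonneg[of x "{..<a}"] mult_right_le_imp_le[of "L2_set c K" "L2_set c K"]
    by (cases "L2_set c K = 0") auto
  then show ?thesis by (simp add: c_def)
qed

lemma bil_thin_svd:
  assumes "thin_svd a b Y U s V"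
  shows "bil a b x Y y = (\<Sum>k<min a b. s k * (\<Sum>i<a. x i * U i k) * (\<Sum>j<b. y j * V j k))"
proof -
  have "bil a b x Y y = (\<Sum>i<a. \<Sum>j<b. \<Sum>k<min a b. s k * (x i * U i k) * (y j * V j k))"
    using assms unfolding bil_def thin_svd_def
    by (intro sum.cong) (auto simp: sum_distrib_left sum_distrib_right mult_ac intro!: sum.cong)
  also have "\<dots> = (\<Sum>i<a. \<Sum>k<min a b. \<Sum>j<b. s k * (x i * U i k) * (y j * V j k))"
    by (intro sum.cong refl sum.swap)
  also have "\<dots> = (\<Sum>k<min a b. \<Sum>i<a. \<Sum>j<b. s k * (x i * U i k) * (y j * V j k))"
    by (rule sum.swap)
  also have "\<dots> = (\<Sum>k<min a b. s k * (\<Sum>i<a. x i * U i k) * (\<Sum>j<b. y j * V j k))"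
    by (simp add: sum_distrib_left sum_distrib_right mult_ac)
  finally show ?thesis .
qed

lemma thin_svd_transpose:
  "thin_svd a b Y U s V \<Longrightarrow> thin_svd b a (\<lambda>j i. Y i j) V s U"
  unfolding thin_svd_def by (auto simp: min.commute mult_ac)

lemma thin_svd_right:
  assumes "thin_svd a b Y U s V" "k < min a b" "i < a"
  shows "(\<Sum>j<b. Y i j * V j k) = s k * U i k"
proof -
  have "(\<Sum>j<b. Y i j * V j k) = (\<Sum>j<b. (\<Sum>l<min a b. (s l * U i l) * V j l) * V j k)"
    using assms unfolding thin_svd_def by (intro sum.cong) auto
  also have "\<dots> = s k * U i k"
    using assms by (subst orthonormal_cols_coeff[of b "min a b" V]) (auto simp: thin_svd_def)
  finally show ?thesis .
qed

text \<open>Indices start at 0, so \<open>s r\<close> is the (r+1)-st singular value. Among the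
  combinations of the r + 1 leading right singular vectors some nonzero y is orthogonal to the r
  columns of Q. The rank-r part vanishes on it, while Y, paired with the same combination x of left
  singular vectors, gives at least \<open>s r\<close> |c|^2.\<close>

lemma weyl_upper:
  assumes svd: "thin_svd a b Y U s V" and r: "r < min a b"
    and Y: "\<And>i j. i < a \<Longrightarrow> j < b \<Longrightarrow> Y i j = (\<Sum>k<r. P i k * Q j k) + E i j"
    and op: "\<And>x y. \<bar>bil a b x E y\<bar> \<le> B * vnorm a x * vnorm b y"
  shows "s r \<le> B"
proof -
  obtain c where c0: "\<exists>l\<in>{..r}. c l \<noteq> 0"
    and c: "\<forall>i<r. (\<Sum>l\<in>{..r}. c l * (\<Sum>j<b. V j l * Q j i)) = 0"
    using underdetermined_system[of "{..r}" r "\<lambda>i l. \<Sum>j<b. V j l * Q j i"] by auto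
  define x where "x = (\<lambda>i. \<Sum>l\<in>{..r}. c l * U i l)"
  define y where "y = (\<lambda>j. \<Sum>l\<in>{..r}. c l * V j l)"
  let ?N = "L2_set c {..r}"
  have oU: "orthonormal_cols a (min a b) U" and oV: "orthonormal_cols b (min a b) V"
    and smono: "\<And>k1 k2. k1 \<le> k2 \<Longrightarrow> k2 < min a b \<Longrightarrow> s k2 \<le> s k1"
    using svd unfolding thin_svd_def by auto
  have sub: "{..r} \<subseteq> {..<min a b}" using r by auto
  have N: "?N > 0"
  proof -
    have "?N \<noteq> 0" using c0 by (auto simp: L2_set_eq_0_iff)
    then show ?thesis using L2_set_nonneg[of c "{..r}"] by linarith
  qed
  have nx: "vnorm a x = ?N" "vnorm b y = ?N"
    unfolding x_def y_def using orthonormal_cols_norm oU oV sub by blast+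
  have "bil a b x Y y = (\<Sum>k<min a b. s k * (if k \<in> {..r} then c k else 0) * (if k \<in> {..r} then c k else 0))"
    unfolding bil_thin_svd[OF svd] x_def y_def
    by (intro sum.cong refl) (simp only: orthonormal_cols_coeff[OF oU sub] orthonormal_cols_coeff[OF oV sub] lessThan_iff)
  also have "\<dots> = (\<Sum>k\<in>{..r}. s k * (c k * c k))"
    by (rule sum.mono_neutral_cong_right) (use sub in auto)
  also have "\<dots> \<ge> (\<Sum>k\<in>{..r}. s r * (c k * c k))"
    by (intro sum_mono mult_right_mono smono) (use r in auto)
  finally have ge: "s r * ?N\<^sup>2 \<le> bil a b x Y y"
    unfolding L2_set_squared by (simp add: sum_distrib_left power2_eq_square)
  have "bil a b x Y y = (\<Sum>i<a. \<Sum>j<b. (\<Sum>k<r. x i * P i k * (y j * Q j k))) + bil a b x E y"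
    unfolding bil_def sum.distrib[symmetric] using Y
    by (intro sum.cong refl) (simp add: algebra_simps sum_distrib_left)
  also have "(\<Sum>i<a. \<Sum>j<b. (\<Sum>k<r. x i * P i k * (y j * Q j k)))
     = (\<Sum>i<a. \<Sum>k<r. x i * P i k * (\<Sum>j<b. y j * Q j k))"
    unfolding sum_distrib_left by (intro sum.cong refl sum.swap)
  also have "\<dots> = 0"
  proof -
    have "(\<Sum>j<b. y j * Q j k) = 0" if "k < r" for k
    proof -
      have "(\<Sum>j<b. y j * Q j k) = (\<Sum>l\<in>{..r}. c l * (\<Sum>j<b. V j l * Q j k))"
        unfolding y_def sum_distrib_left sum_distrib_right mult.assoc by (rule sum.swap)
      then show ?thesis using c that by simp
    qed
    then show ?thesis by simp
  qed
  finally have "bil a b x Y y \<le> B * ?N\<^sup>2" using op[of x y] nx by (simp add: power2_eq_square)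
  with ge have "s r * ?N\<^sup>2 \<le> B * ?N\<^sup>2" by simp
  then show ?thesis using N by simp
qed

text \<open>A min-max argument on the test spaces spanned by the columns of P and Q. Some nonzero
  coefficient vector c makes y orthogonal to the first k right singular vectors; this alone kills
  the first k terms of the expansion, since each is a product, and the rest is at most
  \<open>s k\<close> |x| |y|. The columns need not be orthonormal: N1 and N2 measure the
  distortion.\<close>

lemma weyl_lower:
  assumes svd: "thin_svd a b Y U s V" and r: "r \<le> min a b" and k: "k < r"
    and P: "\<And>c. vnorm a (\<lambda>i. \<Sum>l<r. c l * P i l) \<le> N1 * vnorm r c"
    and Q: "\<And>c. vnorm b (\<lambda>j. \<Sum>l<r. c l * Q j l) \<le> N2 * vnorm r c"
    and D: "\<And>c. D * (vnorm r c)\<^sup>2 \<le> bil a b (\<lambda>i. \<Sum>l<r. c l * P i l) Y (\<lambda>j. \<Sum>l<r. c l * Q j l)"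
    and N0: "0 \<le> N1" "0 \<le> N2"
  shows "D \<le> s k * (N1 * N2)"
proof -
  obtain c where c0: "\<exists>l\<in>{..<r}. c l \<noteq> 0"
    and c: "\<forall>i<k. (\<Sum>l<r. c l * (\<Sum>j<b. Q j l * V j i)) = 0"
    using underdetermined_system[of "{..<r}" k "\<lambda>i l. \<Sum>j<b. Q j l * V j i"] k by auto
  define x where "x = (\<lambda>i. \<Sum>l<r. c l * P i l)"
  define y where "y = (\<lambda>j. \<Sum>l<r. c l * Q j l)"
  let ?N = "vnorm r c"
  have oU: "orthonormal_cols a (min a b) U" and oV: "orthonormal_cols b (min a b) V"
    and s0: "\<And>k. k < min a b \<Longrightarrow> 0 \<le> s k"
    and smono: "\<And>k1 k2. k1 \<le> k2 \<Longrightarrow> k2 < min a b \<Longrightarrow> s k2 \<le> s k1"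
    using svd unfolding thin_svd_def by auto
  have N: "?N > 0"
  proof -
    have "?N \<noteq> 0" using c0 by (auto simp: L2_set_eq_0_iff)
    then show ?thesis using L2_set_nonneg[of c "{..<r}"] by linarith
  qed
  have zero: "(\<Sum>j<b. y j * V j i) = 0" if "i < k" for i
  proof -
    have "(\<Sum>j<b. y j * V j i) = (\<Sum>l<r. c l * (\<Sum>j<b. Q j l * V j i))"
      unfolding y_def sum_distrib_left sum_distrib_right mult.assoc by (rule sum.swap)
    then show ?thesis using c that by simp
  qed
  let ?K = "{k..<min a b}"
  have sub: "?K \<subseteq> {..<min a b}" by auto
  have "D * ?N\<^sup>2 \<le> bil a b x Y y" using D unfolding x_def y_def .
  also have "bil a b x Y y = (\<Sum>l\<in>?K. s l * (\<Sum>i<a. x i * U i l) * (\<Sum>j<b. y j * V j l))"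
    unfolding bil_thin_svd[OF svd] by (rule sum.mono_neutral_right) (use zero in auto)
  also have "\<dots> \<le> s k * L2_set (\<lambda>l. \<Sum>i<a. x i * U i l) ?K * L2_set (\<lambda>l. \<Sum>j<b. y j * V j l) ?K"
    by (rule abs_le_D1, rule weighted_sum_mult_le) (use s0 smono in auto)
  also have "\<dots> \<le> s k * vnorm a x * vnorm b y"
    by (intro mult_mono order_refl orthonormal_cols_bessel[OF oU sub] orthonormal_cols_bessel[OF oV sub] mult_nonneg_nonneg s0)
      (use k r in auto)
  also have "\<dots> \<le> s k * (N1 * ?N) * (N2 * ?N)"
    unfolding x_def y_def
    by (intro mult_mono order_refl P Q mult_nonneg_nonneg s0 L2_set_nonneg)
      (use k r N0 in auto)
  finally have "D * ?N\<^sup>2 \<le> s k * (N1 * N2) * ?N\<^sup>2" by (simp add: power2_eq_square mult_ac)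
  then show ?thesis using N by simp
qed

subsection \<open>K-means\<close>

text \<open>The true centres give an objective of at most a \<eta>^2 and every cluster holds a share
  \<alpha> of the rows, so each cluster has a member whose row in C is within K \<eta> of its row in
  U. These p representatives lie within (1 + K) \<eta> of separated centres, hence are distinct and
  exhaust the rows of C. A row of U lies within (2 + K) \<eta> of its own representative and at
  least \<rho> - (2 + K) \<eta> from any other, which explains the constant 4 + 2 K.\<close>

lemma kmeans_recovers_clusters:
  assumes km: "kmeans_sol a r p U C" and lab: "labeling a r p C tauh"
    and range: "\<And>i. i < a \<Longrightarrow> tau i < p"
    and size: "\<And>t. t < p \<Longrightarrow> \<alpha> * real a \<le> real (card {i. i < a \<and> tau i = t})"
    and a: "0 < a" and \<alpha>: "0 < \<alpha>" and K: "0 < K" "1 \<le> K\<^sup>2 * \<alpha>"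
    and near: "\<And>i. i < a \<Longrightarrow> vnorm r (\<lambda>k. U i k - \<nu> (tau i) k) \<le> \<eta>"
    and sep: "\<And>t t'. t < p \<Longrightarrow> t' < p \<Longrightarrow> t \<noteq> t' \<Longrightarrow> \<rho> \<le> vnorm r (\<lambda>k. \<nu> t k - \<nu> t' k)"
    and small: "(4 + 2 * K) * \<eta> < \<rho>"
  shows "\<exists>\<omega>. \<omega> permutes {..<p} \<and> hamming a tauh (\<omega> \<circ> tau) = 0"
proof -
  define D :: "(nat \<Rightarrow> real) \<Rightarrow> (nat \<Rightarrow> real) \<Rightarrow> real" where "D = (\<lambda>u v. vnorm r (\<lambda>k. u k - v k))"
  have tri: "D u w \<le> D u v + D v w" for u v w
    using L2_set_triangle_ineq[of "\<lambda>k. u k - v k" "\<lambda>k. v k - w k" "{..<r}"] by (simp add: D_def)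
  have D_sym: "D u v = D v u" for u v
    unfolding D_def L2_set_def by (simp add: power2_commute)
  have D0: "0 \<le> D u v" for u v by (simp add: D_def)
  have D_cong: "D u v = D u' v" if "map u [0..<r] = map u' [0..<r]" for u u' v
    using that unfolding D_def L2_set_def by simp
  have frob: "frob_dist2 a r A B = (\<Sum>i<a. (D (A i) (B i))\<^sup>2)" for A B
    unfolding frob_dist2_def D_def L2_set_squared ..
  have few: "few_rows a r p C"
    and opt: "\<And>C'. few_rows a r p C' \<Longrightarrow> frob_dist2 a r C U \<le> frob_dist2 a r C' U"
    using km unfolding kmeans_sol_def by auto
  have \<eta>: "0 \<le> \<eta>" using near[OF a] L2_set_nonneg order_trans by blast
  have "few_rows a r p (\<lambda>i. \<nu> (tau i))"
  proof -
    have "mrow r (\<lambda>i. \<nu> (tau i)) ` {..<a} \<subseteq> mrow r \<nu> ` {..<p}"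
      using range by (auto simp: mrow_def)
    then have "card (mrow r (\<lambda>i. \<nu> (tau i)) ` {..<a}) \<le> card (mrow r \<nu> ` {..<p})"
      by (intro card_mono) auto
    also have "\<dots> \<le> p" using card_image_le[of "{..<p}" "mrow r \<nu>"] by simp
    finally show ?thesis unfolding few_rows_def .
  qed
  then have "frob_dist2 a r C U \<le> frob_dist2 a r (\<lambda>i. \<nu> (tau i)) U" by (rule opt)
  also have "\<dots> \<le> (\<Sum>i<a. \<eta>\<^sup>2)"
    unfolding frob using near D_sym by (intro sum_mono power_mono D0) (auto simp: D_def)
  finally have obj: "(\<Sum>i<a. (D (C i) (U i))\<^sup>2) \<le> real a * \<eta>\<^sup>2" by (simp add: frob)
  have "\<exists>i. i < a \<and> tau i = t \<and> D (C i) (U i) \<le> K * \<eta>" if t: "t < p" for t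
  proof (rule ccontr)
    let ?I = "{i. i < a \<and> tau i = t}"
    assume "\<not> ?thesis"
    then have far: "K * \<eta> < D (C i) (U i)" if "i \<in> ?I" for i using that by force
    \<comment> \<open>The strict inequality between sums below needs a member of the
      cluster.\<close>
    have ne: "?I \<noteq> {}"
    proof
      assume "?I = {}"
      then have "\<alpha> * real a \<le> 0" using size[OF t] by (metis card.empty of_nat_0)
      then show False using a \<alpha> by (simp add: mult_le_0_iff)
    qed
    have "real a * \<eta>\<^sup>2 \<le> (K\<^sup>2 * \<alpha>) * (real a * \<eta>\<^sup>2)"
      using mult_right_mono[OF K(2), of "real a * \<eta>\<^sup>2"] by simp
    also have "\<dots> = (\<alpha> * real a) * (K * \<eta>)\<^sup>2" by (simp add: power2_eq_square)
    also have "\<dots> \<le> real (card ?I) * (K * \<eta>)\<^sup>2"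
      by (intro mult_right_mono size t) auto
    also have "\<dots> = (\<Sum>i\<in>?I. (K * \<eta>)\<^sup>2)" by simp
    also have "\<dots> < (\<Sum>i\<in>?I. (D (C i) (U i))\<^sup>2)"
      using far ne K \<eta> by (intro sum_strict_mono power_strict_mono) auto
    also have "\<dots> \<le> (\<Sum>i<a. (D (C i) (U i))\<^sup>2)" by (intro sum_mono2) auto
    finally show False using obj by simp
  qed
  then obtain f where f: "\<And>t. t < p \<Longrightarrow> f t < a" "\<And>t. t < p \<Longrightarrow> tau (f t) = t"
    "\<And>t. t < p \<Longrightarrow> D (C (f t)) (U (f t)) \<le> K * \<eta>"
    by metis
  have center: "D (C (f t)) (\<nu> t) \<le> (1 + K) * \<eta>" if "t < p" for t
    using tri[of "C (f t)" "\<nu> t" "U (f t)"] f[OF that] near[of "f t"] by (simp add: D_def algebra_simps)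
  have sepD: "\<rho> \<le> D (\<nu> t) (\<nu> t')" if "t < p" "t' < p" "t \<noteq> t'" for t t'
    using sep[OF that] by (simp add: D_def)
  have inj: "inj_on (\<lambda>t. mrow r C (f t)) {..<p}"
  proof (rule inj_onI, rule ccontr)
    fix t t' assume *: "t \<in> {..<p}" "t' \<in> {..<p}" "mrow r C (f t) = mrow r C (f t')" "t \<noteq> t'"
    then have tt: "t < p" "t' < p" by auto
    have "D (C (f t)) (\<nu> t') \<le> (1 + K) * \<eta>"
      using center[OF tt(2)] D_cong[of "C (f t)" "C (f t')" "\<nu> t'"] *(3) by (simp add: mrow_def)
    then have "\<rho> \<le> (1 + K) * \<eta> + (1 + K) * \<eta>"
      using sepD[OF tt *(4)] tri[of "\<nu> t" "\<nu> t'" "C (f t)"] center[OF tt(1)]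
        D_sym[of "\<nu> t" "C (f t)"]
      by linarith
    moreover have "(1 + K) * \<eta> + (1 + K) * \<eta> \<le> (4 + 2 * K) * \<eta>" using \<eta> by (simp add: algebra_simps)
    ultimately show False using small by linarith
  qed
  \<comment> \<open>\<open>few_rows\<close> allows at most p distinct rows, and the representatives
    already are p of them.\<close>
  have rows: "(\<lambda>t. mrow r C (f t)) ` {..<p} = mrow r C ` {..<a}"
    using few f(1) unfolding few_rows_def by (intro card_seteq) (auto simp: card_image[OF inj])
  have own: "mrow r C i = mrow r C (f (tau i))" if i: "i < a" for i
  proof (rule ccontr)
    assume ne: "mrow r C i \<noteq> mrow r C (f (tau i))"
    have t: "tau i < p" using range i .
    have "mrow r C i \<in> (\<lambda>t. mrow r C (f t)) ` {..<p}" unfolding rows using i by simp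
    then obtain t' where t': "t' < p" "mrow r C i = mrow r C (f t')" by blast
    with ne have "tau i \<noteq> t'" by auto
    \<comment> \<open>Exchange: row i takes over the row of its own representative. No new row value
      arises, so the competitor is admissible, and only one term of the objective changes.\<close>
    let ?C = "C(i := C (f (tau i)))"
    have "mrow r ?C ` {..<a} \<subseteq> mrow r C ` {..<a}"
    proof
      fix z assume "z \<in> mrow r ?C ` {..<a}"
      then obtain j where "j < a" "z = mrow r ?C j" by auto
      then show "z \<in> mrow r C ` {..<a}" using f(1)[OF t] by (cases "j = i") (auto simp: mrow_def)
    qed
    then have "card (mrow r ?C ` {..<a}) \<le> card (mrow r C ` {..<a})" by (intro card_mono) auto
    then have "few_rows a r p ?C" using few unfolding few_rows_def by simp
    then have le: "frob_dist2 a r C U \<le> frob_dist2 a r ?C U" by (rule opt)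
    have nr: "D (\<nu> (tau i)) (U i) \<le> \<eta>" using near[OF i] D_sym by (simp add: D_def)
    have "D (C (f (tau i))) (U i) \<le> (2 + K) * \<eta>"
      using tri[of "C (f (tau i))" "U i" "\<nu> (tau i)"] nr center[OF t] by (simp add: algebra_simps)
    also have "\<dots> < \<rho> - (2 + K) * \<eta>" using small by (simp add: algebra_simps)
    also have "\<dots> \<le> D (C i) (U i)"
    proof -
      have "D (C i) (U i) = D (C (f t')) (U i)" using t' D_cong by (simp add: mrow_def)
      moreover have "\<rho> \<le> D (\<nu> (tau i)) (U i) + D (C (f t')) (U i) + D (C (f t')) (\<nu> t')"
        using sepD[OF t t'(1) \<open>tau i \<noteq> t'\<close>] tri[of "\<nu> (tau i)" "\<nu> t'" "U i"]
          tri[of "U i" "\<nu> t'" "C (f t')"] D_sym[of "U i" "C (f t')"] by linarith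
      ultimately show ?thesis using nr center[OF t'(1)] by (simp add: algebra_simps)
    qed
    finally have lt: "D (C (f (tau i))) (U i) < D (C i) (U i)" .
    have "frob_dist2 a r ?C U < frob_dist2 a r C U"
      unfolding frob
      by (rule sum_strict_mono_ex1) (use i lt D0 in \<open>auto intro!: power_mono power_strict_mono\<close>)
    then show False using le by simp
  qed
  have lab_lt: "\<And>i. i < a \<Longrightarrow> tauh i < p"
    and lab_iff: "\<And>i i'. i < a \<Longrightarrow> i' < a \<Longrightarrow> tauh i = tauh i' \<longleftrightarrow> mrow r C i = mrow r C i'"
    using lab unfolding labeling_def by auto
  \<comment> \<open>\<open>permutes\<close> asks for the identity outside
    \<open>{..<p}\<close>.\<close>
  define \<omega> where "\<omega> = (\<lambda>t. if t < p then tauh (f t) else t)"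
  have inj\<omega>: "inj_on \<omega> {..<p}"
    using inj f(1) lab_iff unfolding \<omega>_def inj_on_def by auto
  have "\<omega> ` {..<p} \<subseteq> {..<p}" using f(1) lab_lt by (auto simp: \<omega>_def)
  then have "\<omega> ` {..<p} = {..<p}" by (rule endo_inj_surj[OF finite_lessThan _ inj\<omega>])
  then have "bij_betw \<omega> {..<p} {..<p}" using inj\<omega> by (simp add: bij_betw_def)
  then have "\<omega> permutes {..<p}" by (rule bij_imp_permutes) (simp add: \<omega>_def)
  moreover have "tauh i = \<omega> (tau i)" if "i < a" for i
    using own[OF that] range[OF that] f(1) lab_iff that unfolding \<omega>_def by auto
  then have "hamming a tauh (\<omega> \<circ> tau) = 0" unfolding hamming_def by (auto simp: card_eq_0_iff)
  ultimately show ?thesis by blast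
qed

subsection \<open>Signal plus bounded noise\<close>

lemma bil_add: "bil a b x (\<lambda>i j. A i j + E i j) y = bil a b x A y + bil a b x E y"
  unfolding bil_def by (simp add: algebra_simps sum.distrib)

abbreviation (input) cluster_size :: "nat \<Rightarrow> (nat \<Rightarrow> nat) \<Rightarrow> nat \<Rightarrow> real" where
  "cluster_size a tau s \<equiv> real (card {i. i < a \<and> tau i = s})"

lemma sum_by_cluster:
  fixes f :: "nat \<Rightarrow> real" and tau :: "nat \<Rightarrow> nat"
  assumes "\<And>i. i < a \<Longrightarrow> tau i < p"
  shows "(\<Sum>i<a. f (tau i) * g i) = (\<Sum>s<p. f s * (\<Sum>i | i < a \<and> tau i = s. g i))"
proof -
  have sub: "tau ` {..<a} \<subseteq> {..<p}" using assms by auto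
  have "(\<Sum>i<a. f (tau i) * g i) = (\<Sum>s<p. \<Sum>i | i \<in> {..<a} \<and> tau i = s. f (tau i) * g i)"
    by (rule sum.group[OF finite_lessThan finite_lessThan sub, symmetric])
  also have "\<dots> = (\<Sum>s<p. f s * (\<Sum>i | i < a \<and> tau i = s. g i))"
    by (simp add: sum_distrib_left)
  finally show ?thesis .
qed

lemma sum_by_cluster_size:
  fixes f :: "nat \<Rightarrow> real"
  assumes "\<And>i. i < a \<Longrightarrow> tau i < p"
  shows "(\<Sum>i<a. f (tau i)) = (\<Sum>s<p. cluster_size a tau s * f s)"
  using sum_by_cluster[OF assms, where f = f and g = "\<lambda>_. 1"] by (simp add: mult.commute)

text \<open>In the squared norm cluster s is counted N_s times; having divided by N_s leaves one
  factor 1 / N_s, at most 1 / (\<alpha> a), and W preserves the norm of c.\<close>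

lemma cluster_average_norm:
  assumes W: "orthonormal_cols p r W" and range: "\<And>i. i < a \<Longrightarrow> tau i < p"
    and size: "\<And>s. s < p \<Longrightarrow> \<alpha> * real a \<le> cluster_size a tau s"
    and pos: "0 < \<alpha>" "0 < a"
  shows "vnorm a (\<lambda>i. \<Sum>l<r. c l * (W (tau i) l / cluster_size a tau (tau i)))
    \<le> 1 / (sqrt \<alpha> * sqrt (real a)) * vnorm r c"
proof -
  define z where "z = (\<lambda>s. \<Sum>l<r. c l * W s l)"
  define N where "N = cluster_size a tau"
  have N: "0 < \<alpha> * real a" "\<And>s. s < p \<Longrightarrow> \<alpha> * real a \<le> N s" using pos size by (auto simp: N_def)
  have "(vnorm a (\<lambda>i. \<Sum>l<r. c l * (W (tau i) l / N (tau i))))\<^sup>2 = (\<Sum>i<a. (z (tau i) / N (tau i))\<^sup>2)"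
    unfolding L2_set_squared z_def by (simp add: sum_divide_distrib)
  also have "\<dots> = (\<Sum>s<p. N s * (z s / N s)\<^sup>2)"
    unfolding N_def by (rule sum_by_cluster_size) (rule range)
  also have "\<dots> \<le> (\<Sum>s<p. 1 / (\<alpha> * real a) * (z s)\<^sup>2)"
  proof (rule sum_mono)
    fix s assume "s \<in> {..<p}"
    then have "\<alpha> * real a \<le> N s" "0 < N s" using N by force+
    then show "N s * (z s / N s)\<^sup>2 \<le> 1 / (\<alpha> * real a) * (z s)\<^sup>2"
      using N by (simp add: power2_eq_square divide_left_mono mult_pos_pos)
  qed
  also have "\<dots> = 1 / (\<alpha> * real a) * (vnorm p z)\<^sup>2"
    unfolding L2_set_squared sum_distrib_left ..
  also have "vnorm p z = vnorm r c"
    unfolding z_def using orthonormal_cols_norm[OF W order_refl] .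
  also have "1 / (\<alpha> * real a) * (vnorm r c)\<^sup>2 = (1 / (sqrt \<alpha> * sqrt (real a)) * vnorm r c)\<^sup>2"
    using pos by (simp add: power_mult_distrib power_divide)
  finally show ?thesis unfolding N_def
    by (rule power2_le_imp_le) (use pos in simp)
qed

text \<open>Dividing by the cluster sizes cancels the multiplicities of the clusters, so that the form
  becomes diagonal in \<open>c\<close>.\<close>

lemma bil_cluster_averages:
  assumes W1: "orthonormal_cols p1 r W1" and W2: "orthonormal_cols p2 r W2"
    and S: "\<And>s t. s < p1 \<Longrightarrow> t < p2 \<Longrightarrow> S s t = (\<Sum>k<r. W1 s k * d k * W2 t k)"
    and tau: "\<And>i. i < a \<Longrightarrow> tau i < p1" and gamma: "\<And>j. j < b \<Longrightarrow> gamma j < p2"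
    and pos1: "\<And>s. s < p1 \<Longrightarrow> 0 < cluster_size a tau s"
    and pos2: "\<And>t. t < p2 \<Longrightarrow> 0 < cluster_size b gamma t"
  shows "bil a b (\<lambda>i. \<Sum>l<r. c l * (W1 (tau i) l / cluster_size a tau (tau i)))
      (\<lambda>i j. S (tau i) (gamma j))
      (\<lambda>j. \<Sum>l<r. c l * (W2 (gamma j) l / cluster_size b gamma (gamma j))) = (\<Sum>k<r. d k * (c k)\<^sup>2)"
proof -
  define z1 where "z1 = (\<lambda>s. \<Sum>l<r. c l * W1 s l)"
  define z2 where "z2 = (\<lambda>t. \<Sum>l<r. c l * W2 t l)"
  define N1 where "N1 = cluster_size a tau"
  define N2 where "N2 = cluster_size b gamma"
  have "bil a b (\<lambda>i. \<Sum>l<r. c l * (W1 (tau i) l / N1 (tau i))) (\<lambda>i j. S (tau i) (gamma j))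
      (\<lambda>j. \<Sum>l<r. c l * (W2 (gamma j) l / N2 (gamma j)))
    = (\<Sum>i<a. \<Sum>j<b. (z1 (tau i) / N1 (tau i)) * S (tau i) (gamma j) * (z2 (gamma j) / N2 (gamma j)))"
    unfolding bil_def z1_def z2_def by (simp add: sum_divide_distrib)
  also have "\<dots> = (\<Sum>i<a. \<Sum>t<p2. N2 t * ((z1 (tau i) / N1 (tau i)) * S (tau i) t * (z2 t / N2 t)))"
    unfolding N2_def by (intro sum.cong refl sum_by_cluster_size gamma)
  also have "\<dots> = (\<Sum>s<p1. N1 s * (\<Sum>t<p2. N2 t * ((z1 s / N1 s) * S s t * (z2 t / N2 t))))"
    unfolding N1_def by (rule sum_by_cluster_size) (rule tau)
  also have "\<dots> = (\<Sum>s<p1. \<Sum>t<p2. z1 s * S s t * z2 t)"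
    unfolding sum_distrib_left
  proof (intro sum.cong refl)
    fix s t assume "s \<in> {..<p1}" "t \<in> {..<p2}"
    then have "0 < N1 s" "0 < N2 t" using pos1[of s] pos2[of t] unfolding N1_def N2_def by blast+
    then show "N1 s * (N2 t * ((z1 s / N1 s) * S s t * (z2 t / N2 t))) = z1 s * S s t * z2 t"
      by simp
  qed
  also have "\<dots> = (\<Sum>s<p1. \<Sum>t<p2. \<Sum>k<r. d k * (z1 s * W1 s k) * (z2 t * W2 t k))"
    by (intro sum.cong refl) (simp add: S sum_distrib_left sum_distrib_right mult_ac)
  also have "\<dots> = (\<Sum>s<p1. \<Sum>k<r. \<Sum>t<p2. d k * (z1 s * W1 s k) * (z2 t * W2 t k))"
    by (intro sum.cong refl sum.swap)
  also have "\<dots> = (\<Sum>k<r. \<Sum>s<p1. \<Sum>t<p2. d k * (z1 s * W1 s k) * (z2 t * W2 t k))"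
    by (rule sum.swap)
  also have "\<dots> = (\<Sum>k<r. d k * (\<Sum>s<p1. z1 s * W1 s k) * (\<Sum>t<p2. z2 t * W2 t k))"
    by (simp add: sum_distrib_left sum_distrib_right mult_ac)
  also have "\<dots> = (\<Sum>k<r. d k * (c k)\<^sup>2)"
  proof (intro sum.cong refl)
    fix k assume k: "k \<in> {..<r}"
    have "(\<Sum>s<p1. z1 s * W1 s k) = c k" "(\<Sum>t<p2. z2 t * W2 t k) = c k"
      unfolding z1_def z2_def using k orthonormal_cols_coeff[OF W1 order_refl, of k c]
        orthonormal_cols_coeff[OF W2 order_refl, of k c] by auto
    then show "d k * (\<Sum>s<p1. z1 s * W1 s k) * (\<Sum>t<p2. z2 t * W2 t k) = d k * (c k)\<^sup>2"
      by (simp add: power2_eq_square)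
  qed
  finally show ?thesis unfolding N1_def N2_def .
qed

text \<open>One realisation of the noise, known through its operator norm; bounds on entries and
  cluster sums are added where they are needed. The assumptions are symmetric under exchanging rows
  and columns, so the locale can be instantiated for Y and for its transpose. The strict
  \<open>r < min a b\<close> provides a singular value \<open>s r\<close> beyond the rank of the
  signal.\<close>

locale perturbed_biclustering =
  fixes a b p1 p2 r :: nat and W1 W2 :: "nat \<Rightarrow> nat \<Rightarrow> real" and d :: "nat \<Rightarrow> real"
    and S0 :: "nat \<Rightarrow> nat \<Rightarrow> real" and tau gamma :: "nat \<Rightarrow> nat" and \<alpha> dm S :: real
    and E :: "nat \<Rightarrow> nat \<Rightarrow> real" and B :: real and U V :: "nat \<Rightarrow> nat \<Rightarrow> real" and s :: "nat \<Rightarrow> real"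
  assumes W1: "orthonormal_cols p1 r W1" and W2: "orthonormal_cols p2 r W2"
    and S0: "\<And>s t. s < p1 \<Longrightarrow> t < p2 \<Longrightarrow> S0 s t = (\<Sum>k<r. W1 s k * d k * W2 t k)"
    and dm: "0 < dm" "\<And>k. k < r \<Longrightarrow> dm \<le> d k"
    and S: "0 \<le> S" "\<And>s t. s < p1 \<Longrightarrow> t < p2 \<Longrightarrow> \<bar>S0 s t\<bar> \<le> S"
    and tau: "\<And>i. i < a \<Longrightarrow> tau i < p1" and gamma: "\<And>j. j < b \<Longrightarrow> gamma j < p2"
    and \<alpha>: "0 < \<alpha>"
    and size1: "\<And>s. s < p1 \<Longrightarrow> \<alpha> * real a \<le> cluster_size a tau s"
    and size2: "\<And>t. t < p2 \<Longrightarrow> \<alpha> * real b \<le> cluster_size b gamma t"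
    and r: "r < min a b"
    and op: "\<And>x y. \<bar>bil a b x E y\<bar> \<le> B * vnorm a x * vnorm b y"
    and svd: "thin_svd a b (\<lambda>i j. S0 (tau i) (gamma j) + E i j) U s V"
begin

lemma dims_pos: "0 < a" "0 < b" "0 < sqrt (real a)" "0 < sqrt (real b)"
  using r by auto

lemma size1_pos: "t < p1 \<Longrightarrow> 0 < cluster_size a tau t"
  and size2_pos: "t < p2 \<Longrightarrow> 0 < cluster_size b gamma t"
  using size1[of t] size2[of t] \<alpha> dims_pos mult_pos_pos[of \<alpha>] by (smt (verit) of_nat_0_less_iff)+

lemma U: "orthonormal_cols a (min a b) U" and V: "orthonormal_cols b (min a b) V"
  and s_nonneg: "k < min a b \<Longrightarrow> 0 \<le> s k"
  and s_mono: "k1 \<le> k2 \<Longrightarrow> k2 < min a b \<Longrightarrow> s k2 \<le> s k1"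
  using svd unfolding thin_svd_def by auto

lemma col_norm: "k < min a b \<Longrightarrow> vnorm a (\<lambda>i. U i k) = 1" "k < min a b \<Longrightarrow> vnorm b (\<lambda>j. V j k) = 1"
  using U V unfolding orthonormal_cols_def by (auto simp: L2_set_def power2_eq_square)

lemma op_bound_nonneg: "0 \<le> B"
proof -
  have "0 \<le> B * vnorm a (\<lambda>i. U i 0) * vnorm b (\<lambda>j. V j 0)"
    by (rule order_trans[OF abs_ge_zero op])
  then show ?thesis using col_norm[of 0] r by simp
qed

text \<open>Cluster averages of \<open>W1\<close> and \<open>W2\<close> are the test vectors for
  \<open>weyl_lower\<close>. On them the signal is a diagonal form with weights \<open>d k\<close>,
  at least \<open>dm\<close>, and the noise contributes at most B N1 N2, where N1 N2 = 1 / (\<alpha>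
  sqrt(a b)).\<close>

lemma s_lower:
  assumes k: "k < r"
  shows "dm * (\<alpha> * sqrt (real a) * sqrt (real b)) - B \<le> s k"
proof -
  let ?N1 = "1 / (sqrt \<alpha> * sqrt (real a))" and ?N2 = "1 / (sqrt \<alpha> * sqrt (real b))"
  let ?P = "\<lambda>i l. W1 (tau i) l / cluster_size a tau (tau i)"
  let ?Q = "\<lambda>j l. W2 (gamma j) l / cluster_size b gamma (gamma j)"
  have P: "vnorm a (\<lambda>i. \<Sum>l<r. c l * ?P i l) \<le> ?N1 * vnorm r c" for c
    by (rule cluster_average_norm[OF W1 tau size1 \<alpha>]) (use dims_pos in auto)
  have Q: "vnorm b (\<lambda>j. \<Sum>l<r. c l * ?Q j l) \<le> ?N2 * vnorm r c" for c
    by (rule cluster_average_norm[OF W2 gamma size2 \<alpha>]) (use dims_pos in auto)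
  have N0: "0 \<le> ?N1" "0 \<le> ?N2" using \<alpha> by auto
  have main: "dm - B * (?N1 * ?N2) \<le> s k * (?N1 * ?N2)"
  proof (rule weyl_lower[OF svd _ k P Q _ N0])
    show "r \<le> min a b" using r by simp
    fix c
    let ?x = "\<lambda>i. \<Sum>l<r. c l * ?P i l" and ?y = "\<lambda>j. \<Sum>l<r. c l * ?Q j l"
    have "dm * (vnorm r c)\<^sup>2 \<le> (\<Sum>k<r. d k * (c k)\<^sup>2)"
      unfolding L2_set_squared sum_distrib_left using dm by (intro sum_mono mult_right_mono) auto
    also have "\<dots> = bil a b ?x (\<lambda>i j. S0 (tau i) (gamma j)) ?y"
      by (rule bil_cluster_averages[symmetric, OF W1 W2 S0 tau gamma size1_pos size2_pos])
    finally have 1: "dm * (vnorm r c)\<^sup>2 \<le> bil a b ?x (\<lambda>i j. S0 (tau i) (gamma j)) ?y" .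
    have "\<bar>bil a b ?x E ?y\<bar> \<le> B * vnorm a ?x * vnorm b ?y" by (rule op)
    also have "\<dots> \<le> B * (?N1 * vnorm r c) * (?N2 * vnorm r c)"
      using op_bound_nonneg N0 by (intro mult_mono order_refl P Q mult_nonneg_nonneg L2_set_nonneg) auto
    finally have "- (B * (?N1 * ?N2) * (vnorm r c)\<^sup>2) \<le> bil a b ?x E ?y"
      by (simp add: power2_eq_square mult_ac)
    then show "(dm - B * (?N1 * ?N2)) * (vnorm r c)\<^sup>2
        \<le> bil a b ?x (\<lambda>i j. S0 (tau i) (gamma j) + E i j) ?y"
      unfolding bil_add using 1 by (simp add: left_diff_distrib)
  qed
  define Q where "Q = \<alpha> * sqrt (real a) * sqrt (real b)"
  have N12: "?N1 * ?N2 = 1 / Q"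
  proof -
    have "(sqrt \<alpha> * sqrt (real a)) * (sqrt \<alpha> * sqrt (real b)) = (sqrt \<alpha> * sqrt \<alpha>) * sqrt (real a) * sqrt (real b)"
      by (simp only: mult_ac)
    then show ?thesis using \<alpha> by (simp add: Q_def)
  qed
  have "dm - B * (1 / Q) \<le> s k * (1 / Q)" using main unfolding N12 .
  moreover have "0 < Q" unfolding Q_def using \<alpha> dims_pos by simp
  ultimately have "(dm - B * (1 / Q)) * Q \<le> s k" by (simp add: pos_le_divide_eq)
  then have "dm * Q - B \<le> s k" using \<open>0 < Q\<close> by (simp add: left_diff_distrib)
  then show ?thesis by (simp add: Q_def)
qed

text \<open>A singular value is the form of Y at its unit singular vectors. The signal entries are
  at most S in modulus, and a unit vector with a entries has 1-norm at most sqrt(a).\<close>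

lemma s_upper:
  assumes k: "k < min a b"
  shows "s k \<le> S * (sqrt (real a) * sqrt (real b)) + B"
proof -
  have "s k = bil a b (\<lambda>i. U i k) (\<lambda>i j. S0 (tau i) (gamma j) + E i j) (\<lambda>j. V j k)"
  proof -
    have "bil a b (\<lambda>i. U i k) (\<lambda>i j. S0 (tau i) (gamma j) + E i j) (\<lambda>j. V j k)
       = (\<Sum>i<a. U i k * (\<Sum>j<b. (S0 (tau i) (gamma j) + E i j) * V j k))"
      unfolding bil_def by (simp add: sum_distrib_left mult_ac)
    also have "\<dots> = (\<Sum>i<a. U i k * (s k * U i k))"
      using thin_svd_right[OF svd k] by simp
    also have "\<dots> = s k * (\<Sum>i<a. U i k * U i k)" by (simp add: sum_distrib_left mult_ac)
    finally show ?thesis using U k unfolding orthonormal_cols_def by simp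
  qed
  also have "\<dots> = bil a b (\<lambda>i. U i k) (\<lambda>i j. S0 (tau i) (gamma j)) (\<lambda>j. V j k)
      + bil a b (\<lambda>i. U i k) E (\<lambda>j. V j k)" by (rule bil_add)
  also have "bil a b (\<lambda>i. U i k) E (\<lambda>j. V j k) \<le> B"
    using op[of "\<lambda>i. U i k" "\<lambda>j. V j k"] col_norm[OF k] by simp
  also have "bil a b (\<lambda>i. U i k) (\<lambda>i j. S0 (tau i) (gamma j)) (\<lambda>j. V j k)
      \<le> (\<Sum>i<a. \<Sum>j<b. \<bar>U i k\<bar> * S * \<bar>V j k\<bar>)"
    unfolding bil_def
  proof (intro sum_mono)
    fix i j assume "i \<in> {..<a}" "j \<in> {..<b}"
    then have "\<bar>U i k * S0 (tau i) (gamma j) * V j k\<bar> \<le> \<bar>U i k\<bar> * S * \<bar>V j k\<bar>"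
      unfolding abs_mult using S tau gamma by (intro mult_mono) auto
    then show "U i k * S0 (tau i) (gamma j) * V j k \<le> \<bar>U i k\<bar> * S * \<bar>V j k\<bar>" by linarith
  qed
  also have "\<dots> = S * ((\<Sum>i<a. \<bar>U i k\<bar> * \<bar>1\<bar>) * (\<Sum>j<b. \<bar>V j k\<bar> * \<bar>1\<bar>))"
    unfolding sum_product by (simp add: sum_distrib_left mult_ac)
  also have "\<dots> \<le> S * ((vnorm a (\<lambda>i. U i k) * vnorm a (\<lambda>_. 1)) * (vnorm b (\<lambda>j. V j k) * vnorm b (\<lambda>_. 1)))"
    by (intro mult_left_mono mult_mono L2_set_mult_ineq S mult_nonneg_nonneg sum_nonneg) auto
  also have "\<dots> = S * (sqrt (real a) * sqrt (real b))"
    using col_norm[OF k] by (simp add: L2_set_def)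
  finally show ?thesis by simp
qed

text \<open>The difference of two rows of \<open>S0\<close> has the norm of (W1 t - W1 t') diag(d),
  as W2 has orthonormal columns. The separation is stated with weights sqrt(d), so its square gains
  one more factor \<open>dm\<close>. Every column cluster repeats its entry at least \<alpha> b
  times.\<close>

lemma row_difference_norm:
  assumes t: "t < p1" "t' < p1" and \<delta>: "0 \<le> \<delta>"
    and sep: "\<delta> \<le> sqrt (\<Sum>k<r. (W1 t k * sqrt (d k) - W1 t' k * sqrt (d k))\<^sup>2)"
  shows "\<alpha> * dm * \<delta>\<^sup>2 * real b \<le> (vnorm b (\<lambda>j. S0 t (gamma j) - S0 t' (gamma j)))\<^sup>2"
    and "vnorm b (\<lambda>j. S0 t (gamma j) - S0 t' (gamma j)) \<le> 2 * S * sqrt (real b)"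
proof -
  let ?e = "\<lambda>k. (W1 t k - W1 t' k) * d k"
  have d0: "0 \<le> d k" if "k < r" for k using dm that by force
  have "\<delta>\<^sup>2 \<le> (\<Sum>k<r. (W1 t k * sqrt (d k) - W1 t' k * sqrt (d k))\<^sup>2)"
    using power_mono[OF sep \<delta>, of 2] by (simp add: sum_nonneg)
  also have "\<dots> = (\<Sum>k<r. (W1 t k - W1 t' k)\<^sup>2 * d k)"
    using d0 by (intro sum.cong refl) (simp add: left_diff_distrib[symmetric] power_mult_distrib)
  finally have "dm * \<delta>\<^sup>2 \<le> (\<Sum>k<r. dm * ((W1 t k - W1 t' k)\<^sup>2 * d k))"
    using dm unfolding sum_distrib_left[symmetric] by simp
  also have "\<dots> \<le> (\<Sum>k<r. d k * ((W1 t k - W1 t' k)\<^sup>2 * d k))"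
    using dm d0 by (intro sum_mono mult_right_mono) auto
  also have "\<dots> = (vnorm r ?e)\<^sup>2"
    unfolding L2_set_squared by (simp add: power2_eq_square mult_ac)
  also have "vnorm r ?e = vnorm p2 (\<lambda>u. \<Sum>k<r. ?e k * W2 u k)"
    using orthonormal_cols_norm[OF W2 order_refl, of ?e] by simp
  also have "\<dots>\<^sup>2 = (\<Sum>u<p2. (S0 t u - S0 t' u)\<^sup>2)"
    unfolding L2_set_squared using t
    by (intro sum.cong refl) (simp add: S0 sum_subtractf left_diff_distrib)
  finally have 1: "dm * \<delta>\<^sup>2 \<le> (\<Sum>u<p2. (S0 t u - S0 t' u)\<^sup>2)" .
  have "\<alpha> * dm * \<delta>\<^sup>2 * real b = (\<alpha> * real b) * (dm * \<delta>\<^sup>2)" by simp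
  also have "\<dots> \<le> (\<alpha> * real b) * (\<Sum>u<p2. (S0 t u - S0 t' u)\<^sup>2)"
    using \<alpha> by (intro mult_left_mono 1) auto
  also have "\<dots> \<le> (\<Sum>u<p2. cluster_size b gamma u * (S0 t u - S0 t' u)\<^sup>2)"
    unfolding sum_distrib_left using size2 by (intro sum_mono mult_right_mono) auto
  also have "\<dots> = (\<Sum>j<b. (S0 t (gamma j) - S0 t' (gamma j))\<^sup>2)"
    by (rule sum_by_cluster_size[symmetric]) (rule gamma)
  finally show "\<alpha> * dm * \<delta>\<^sup>2 * real b \<le> (vnorm b (\<lambda>j. S0 t (gamma j) - S0 t' (gamma j)))\<^sup>2"
    by (simp add: L2_set_squared)
  have "(vnorm b (\<lambda>j. S0 t (gamma j) - S0 t' (gamma j)))\<^sup>2 \<le> (\<Sum>j<b. (2 * S)\<^sup>2)"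
    unfolding L2_set_squared
  proof (rule sum_mono)
    fix j assume "j \<in> {..<b}"
    then have "\<bar>S0 t (gamma j) - S0 t' (gamma j)\<bar> \<le> 2 * S"
      using S(2)[OF t(1), of "gamma j"] S(2)[OF t(2), of "gamma j"] gamma by fastforce
    then show "(S0 t (gamma j) - S0 t' (gamma j))\<^sup>2 \<le> (2 * S)\<^sup>2"
      by (metis abs_ge_zero power2_abs power_mono)
  qed
  also have "\<dots> = (2 * S * sqrt (real b))\<^sup>2" by (simp add: power_mult_distrib)
  finally show "vnorm b (\<lambda>j. S0 t (gamma j) - S0 t' (gamma j)) \<le> 2 * S * sqrt (real b)"
    by (rule power2_le_imp_le) (use S in simp)
qed

text \<open>Testing \<open>Y\<close> against the difference of two cluster averages avoids projections: the part of
  the row difference outside the leading right singular space is seen only through \<open>E\<close> and the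
  singular values beyond \<open>r\<close>.\<close>

lemma row_difference_captured:
  assumes t: "t < p1" "t' < p1" "t \<noteq> t'" and T: "\<And>k. k < r \<Longrightarrow> s k \<le> T"
  shows "(vnorm b (\<lambda>j. S0 t (gamma j) - S0 t' (gamma j)))\<^sup>2 \<le> sqrt (2 / \<alpha>) / sqrt (real a) *
     (T * vnorm r (\<lambda>k. \<Sum>j<b. (S0 t (gamma j) - S0 t' (gamma j)) * V j k)
       + 2 * B * vnorm b (\<lambda>j. S0 t (gamma j) - S0 t' (gamma j)))"
proof -
  define A where "A = (\<lambda>j. S0 t (gamma j) - S0 t' (gamma j))"
  define N where "N = cluster_size a tau"
  \<comment> \<open>As a weight on the rows, h averages over cluster t and subtracts the average
    over cluster t', which turns the signal into exactly the row difference A.\<close>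
  define h where "h = (\<lambda>u. (if u = t then 1 / N t else 0) - (if u = t' then 1 / N t' else 0))"
  let ?x = "\<lambda>i. h (tau i)"
  have N: "\<alpha> * real a \<le> N t" "\<alpha> * real a \<le> N t'" "0 < N t" "0 < N t'"
    using size1 size1_pos t by (auto simp: N_def)
  have aa: "0 < \<alpha> * real a" using \<alpha> dims_pos by simp
  have "(vnorm a ?x)\<^sup>2 = (\<Sum>u<p1. N u * (h u)\<^sup>2)"
    unfolding L2_set_squared N_def by (rule sum_by_cluster_size) (rule tau)
  also have "\<dots> = (\<Sum>u<p1. (if u = t then 1 / N t else 0) + (if u = t' then 1 / N t' else 0))"
    using t(3) N by (intro sum.cong refl) (auto simp: h_def power2_eq_square)
  also have "\<dots> = 1 / N t + 1 / N t'"
    using t by (simp add: sum.distrib)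
  also have "\<dots> \<le> 1 / (\<alpha> * real a) + 1 / (\<alpha> * real a)"
    by (intro add_mono divide_left_mono N mult_pos_pos aa order_less_le_trans[OF aa N(1)] order_less_le_trans[OF aa N(2)]) simp_all
  also have "\<dots> = (sqrt (2 / \<alpha>) / sqrt (real a))\<^sup>2"
    using \<alpha> by (simp add: power_divide)
  finally have nx: "vnorm a ?x \<le> sqrt (2 / \<alpha>) / sqrt (real a)"
    by (rule power2_le_imp_le) (use \<alpha> in simp)
  have avg: "(\<Sum>i<a. ?x i * S0 (tau i) (gamma j)) = A j" for j
  proof -
    have "(\<Sum>i<a. ?x i * S0 (tau i) (gamma j)) = (\<Sum>u<p1. N u * (h u * S0 u (gamma j)))"
      unfolding N_def by (rule sum_by_cluster_size[where f = "\<lambda>u. h u * S0 u (gamma j)"]) (rule tau)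
    also have "\<dots> = (\<Sum>u<p1. (if u = t then S0 t (gamma j) else 0) - (if u = t' then S0 t' (gamma j) else 0))"
      using t(3) N by (intro sum.cong refl) (auto simp: h_def)
    finally show ?thesis using t by (simp add: sum_subtractf A_def)
  qed
  \<comment> \<open>For r = 0 nothing constrains T, but a norm over no coordinates vanishes.\<close>
  have T0: "0 \<le> T * vnorm r (\<lambda>k. \<Sum>j<b. A j * V j k)"
  proof (cases "r = 0")
    case False
    then show ?thesis using T[of 0] s_nonneg[of 0] r by (intro mult_nonneg_nonneg) auto
  qed simp
  have "(vnorm b A)\<^sup>2 = bil a b ?x (\<lambda>i j. S0 (tau i) (gamma j)) A"
    unfolding bil_def L2_set_squared
    by (subst sum.swap) (simp add: sum_distrib_right[symmetric] avg power2_eq_square)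
  also have "\<dots> = bil a b ?x (\<lambda>i j. S0 (tau i) (gamma j) + E i j) A - bil a b ?x E A"
    unfolding bil_add by simp
  also have "\<dots> \<le> bil a b ?x (\<lambda>i j. S0 (tau i) (gamma j) + E i j) A + B * vnorm a ?x * vnorm b A"
    using op[of ?x A] by linarith
  also have "bil a b ?x (\<lambda>i j. S0 (tau i) (gamma j) + E i j) A
    = (\<Sum>k<r. s k * (\<Sum>i<a. ?x i * U i k) * (\<Sum>j<b. A j * V j k))
    + (\<Sum>k\<in>{r..<min a b}. s k * (\<Sum>i<a. ?x i * U i k) * (\<Sum>j<b. A j * V j k))"
    unfolding bil_thin_svd[OF svd]
    by (subst sum.union_disjoint[symmetric]) (use r in \<open>auto intro!: sum.cong\<close>)
  also have "(\<Sum>k<r. s k * (\<Sum>i<a. ?x i * U i k) * (\<Sum>j<b. A j * V j k))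
     \<le> T * vnorm r (\<lambda>k. \<Sum>i<a. ?x i * U i k) * vnorm r (\<lambda>k. \<Sum>j<b. A j * V j k)"
    by (rule abs_le_D1, rule weighted_sum_mult_le) (use T s_nonneg r in auto)
  also have "\<dots> \<le> vnorm a ?x * (T * vnorm r (\<lambda>k. \<Sum>j<b. A j * V j k))"
    using mult_right_mono[OF orthonormal_cols_bessel[OF U, of "{..<r}" ?x] T0] r by (simp add: mult_ac)
  also have "(\<Sum>k\<in>{r..<min a b}. s k * (\<Sum>i<a. ?x i * U i k) * (\<Sum>j<b. A j * V j k))
     \<le> s r * L2_set (\<lambda>k. \<Sum>i<a. ?x i * U i k) {r..<min a b} * L2_set (\<lambda>k. \<Sum>j<b. A j * V j k) {r..<min a b}"
    by (rule abs_le_D1, rule weighted_sum_mult_le) (use s_nonneg s_mono in auto)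
  also have "\<dots> \<le> B * vnorm a ?x * vnorm b A"
  proof (intro mult_mono orthonormal_cols_bessel[OF U] orthonormal_cols_bessel[OF V] mult_nonneg_nonneg)
    \<comment> \<open>The signal factors through r dimensions, with the weights d put into the left
      factor, so this singular value is due to noise alone.\<close>
    show "s r \<le> B"
      by (rule weyl_upper[OF svd r _ op, where P = "\<lambda>i k. W1 (tau i) k * d k" and Q = "\<lambda>j. W2 (gamma j)"])
        (simp add: S0 tau gamma)
  qed (use op_bound_nonneg in auto)
  finally have "(vnorm b A)\<^sup>2 \<le> vnorm a ?x *
      (T * vnorm r (\<lambda>k. \<Sum>j<b. A j * V j k) + 2 * B * vnorm b A)"
    by (simp add: algebra_simps)
  also have "\<dots> \<le> sqrt (2 / \<alpha>) / sqrt (real a) *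
      (T * vnorm r (\<lambda>k. \<Sum>j<b. A j * V j k) + 2 * B * vnorm b A)"
    by (intro mult_right_mono nx) (use T0 op_bound_nonneg in auto)
  finally show ?thesis unfolding A_def .
qed

text \<open>Substituting \<open>s k * V j k = (Y\<^sup>T U) j k\<close> replaces the data-dependent
  vector \<open>V\<close> by quantities controlled uniformly in the row index.\<close>

lemma noise_projection:
  assumes k: "k < min a b" and i: "i < a" and \<epsilon>: "0 \<le> \<epsilon>"
    and L: "0 \<le> L" "\<And>j. j < b \<Longrightarrow> \<bar>E i j\<bar> \<le> L"
    and cl: "\<And>t. t < p2 \<Longrightarrow> \<bar>\<Sum>j | j < b \<and> gamma j = t. E i j\<bar> \<le> \<epsilon> * real b"
  shows "s k * \<bar>\<Sum>j<b. E i j * V j k\<bar> \<le> S * real p2 * (\<epsilon> * real b) * sqrt (real a) + B * (sqrt (real b) * L)"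
proof -
  \<comment> \<open>Row l of the noiseless data paired with row i of the noise: a combination of
    sums of \<open>E i\<close> over column clusters, which \<open>cl\<close> bounds.\<close>
  define g where "g = (\<lambda>l. \<Sum>j<b. S0 (tau l) (gamma j) * E i j)"
  have "s k * (\<Sum>j<b. E i j * V j k) = (\<Sum>j<b. E i j * (s k * V j k))"
    by (simp add: sum_distrib_left mult_ac)
  also have "\<dots> = (\<Sum>j<b. E i j * (\<Sum>l<a. (S0 (tau l) (gamma j) + E l j) * U l k))"
    using thin_svd_right[OF thin_svd_transpose[OF svd], of k] k by (intro sum.cong refl) auto
  also have "\<dots> = (\<Sum>j<b. \<Sum>l<a. U l k * (S0 (tau l) (gamma j) + E l j) * E i j)"
    by (simp add: sum_distrib_left mult_ac)
  also have "\<dots> = bil a b (\<lambda>l. U l k) (\<lambda>l j. S0 (tau l) (gamma j) + E l j) (E i)"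
    unfolding bil_def by (rule sum.swap)
  also have "\<dots> = bil a b (\<lambda>l. U l k) (\<lambda>l j. S0 (tau l) (gamma j)) (E i) + bil a b (\<lambda>l. U l k) E (E i)"
    by (rule bil_add)
  also have "bil a b (\<lambda>l. U l k) (\<lambda>l j. S0 (tau l) (gamma j)) (E i) = (\<Sum>l<a. U l k * g l)"
    unfolding bil_def g_def by (simp add: sum_distrib_left mult_ac)
  finally have eq: "s k * (\<Sum>j<b. E i j * V j k) = (\<Sum>l<a. U l k * g l) + bil a b (\<lambda>l. U l k) E (E i)" .
  have g: "\<bar>g l\<bar> \<le> S * real p2 * (\<epsilon> * real b)" if l: "l < a" for l
  proof -
    have "g l = (\<Sum>t<p2. S0 (tau l) t * (\<Sum>j | j < b \<and> gamma j = t. E i j))"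
      unfolding g_def by (rule sum_by_cluster) (rule gamma)
    also have "\<bar>\<dots>\<bar> \<le> (\<Sum>t<p2. S * (\<epsilon> * real b))"
      using l S tau cl \<epsilon> by (intro order_trans[OF sum_abs] sum_mono) (auto simp: abs_mult intro!: mult_mono)
    finally show ?thesis by (simp add: mult_ac)
  qed
  have "\<bar>\<Sum>l<a. U l k * g l\<bar> \<le> vnorm a (\<lambda>l. U l k) * vnorm a g" by (rule sum_mult_le_L2_set)
  also have "vnorm a g \<le> vnorm a (\<lambda>_. S * real p2 * (\<epsilon> * real b))"
  proof -
    have "vnorm a g = vnorm a (\<lambda>l. \<bar>g l\<bar>)" unfolding L2_set_def by simp
    also have "\<dots> \<le> vnorm a (\<lambda>_. S * real p2 * (\<epsilon> * real b))"
      using g by (intro L2_set_mono) auto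
    finally show ?thesis .
  qed
  also have "\<dots> = S * real p2 * (\<epsilon> * real b) * sqrt (real a)"
    using S \<epsilon> by (simp add: L2_set_constant)
  finally have 1: "\<bar>\<Sum>l<a. U l k * g l\<bar> \<le> S * real p2 * (\<epsilon> * real b) * sqrt (real a)"
    using col_norm[OF k] by simp
  have "vnorm b (E i) = vnorm b (\<lambda>j. \<bar>E i j\<bar>)" unfolding L2_set_def by simp
  also have "\<dots> \<le> vnorm b (\<lambda>_. L)" using L by (intro L2_set_mono) auto
  also have "\<dots> = sqrt (real b) * L" using L by (simp add: L2_set_constant)
  finally have "vnorm b (E i) \<le> sqrt (real b) * L" .
  then have 2: "\<bar>bil a b (\<lambda>l. U l k) E (E i)\<bar> \<le> B * (sqrt (real b) * L)"
    using op[of "\<lambda>l. U l k" "E i"] col_norm[OF k] mult_left_mono[OF _ op_bound_nonneg] by fastforce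
  have "s k * \<bar>\<Sum>j<b. E i j * V j k\<bar> = \<bar>s k * (\<Sum>j<b. E i j * V j k)\<bar>"
    using s_nonneg[OF k] by (simp add: abs_mult)
  also have "\<dots> \<le> S * real p2 * (\<epsilon> * real b) * sqrt (real a) + B * (sqrt (real b) * L)"
    unfolding eq using 1 2 by linarith
  finally show ?thesis .
qed

text \<open>The centre of cluster t is its signal row times V, divided by the singular values. It
  depends on the data, but K-means only needs centres close to the rows and apart from each other.
  The conditions \<epsilon> \<le> 1 and \<epsilon> \<le> \<alpha> dm / 2 put \<open>s k\<close>
  between (\<alpha> dm / 2) sqrt(a b) and (S + 1) sqrt(a b), the fourth one absorbs the noise in the
  row differences, and \<open>small\<close> is the K-means condition after cancelling
  sqrt(a).\<close>

lemma clusters_recovered: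
  assumes km: "kmeans_sol a r p1 Uh C" and lab: "labeling a r p1 C tauh"
    and Uh: "\<And>i k. i < a \<Longrightarrow> k < r \<Longrightarrow> Uh i k = U i k"
    and \<delta>: "0 < \<delta>"
    and sep: "\<And>t t'. t < p1 \<Longrightarrow> t' < p1 \<Longrightarrow> t \<noteq> t' \<Longrightarrow>
        \<delta> \<le> sqrt (\<Sum>k<r. (W1 t k * sqrt (d k) - W1 t' k * sqrt (d k))\<^sup>2)"
    and L: "0 \<le> L" "\<And>i j. i < a \<Longrightarrow> j < b \<Longrightarrow> \<bar>E i j\<bar> \<le> L"
    and cl: "\<And>i t. i < a \<Longrightarrow> t < p2 \<Longrightarrow> \<bar>\<Sum>j | j < b \<and> gamma j = t. E i j\<bar> \<le> \<epsilon> * real b"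
    and B: "B \<le> \<epsilon> * (sqrt (real a) * sqrt (real b))" "B * L \<le> \<epsilon> * (sqrt (real a) * sqrt (real b))"
    and \<epsilon>: "0 \<le> \<epsilon>" "\<epsilon> \<le> 1" "\<epsilon> \<le> \<alpha> * dm / 2"
      "\<epsilon> * (4 * S * sqrt (2 / \<alpha>)) \<le> \<alpha> * dm * \<delta>\<^sup>2 / 2"
    and K: "0 < K" "1 \<le> K\<^sup>2 * \<alpha>"
    and small: "\<epsilon> * ((4 + 2 * K) * (real r * (S * real p2 + 1) / (\<alpha> * dm / 2)\<^sup>2))
        < \<alpha> * dm * \<delta>\<^sup>2 / 2 / (sqrt (2 / \<alpha>) * (S + 1)) / (S + 1)"
  shows "\<exists>\<omega>. \<omega> permutes {..<p1} \<and> hamming a tauh (\<omega> \<circ> tau) = 0"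
proof -
  define ra where "ra = sqrt (real a)"
  define rb where "rb = sqrt (real b)"
  \<comment> \<open>Half of the constant in \<open>s_lower\<close>; the other half pays for B.
    Likewise c below is half of the constant in \<open>row_difference_norm\<close>.\<close>
  define \<kappa> where "\<kappa> = \<alpha> * dm / 2"
  define h where "h = sqrt (2 / \<alpha>)"
  define c where "c = \<alpha> * dm * \<delta>\<^sup>2 / 2"
  have pos: "0 < ra" "0 < rb" "0 < \<kappa>" "0 < h" "0 < c" "0 < S + 1"
    using dims_pos \<alpha> dm S \<delta> by (auto simp: ra_def rb_def \<kappa>_def h_def c_def)
  have sq: "real a = ra * ra" "real b = rb * rb" by (simp_all add: ra_def rb_def)
  have T: "s k \<le> (S + 1) * (ra * rb)" if "k < r" for k
  proof -
    have "s k \<le> S * (ra * rb) + B" using s_upper[of k] that r by (simp add: ra_def rb_def)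
    also have "B \<le> 1 * (ra * rb)"
      unfolding ra_def rb_def by (rule order_trans[OF B(1)], rule mult_right_mono[OF \<epsilon>(2)]) simp
    finally show ?thesis by (simp add: algebra_simps)
  qed
  have s_low: "\<kappa> * (ra * rb) \<le> s k" if "k < r" for k
  proof -
    have "2 * \<kappa> * (ra * rb) - B \<le> s k" using s_lower[OF that] by (simp add: \<kappa>_def ra_def rb_def mult_ac)
    moreover have "B \<le> \<kappa> * (ra * rb)"
      unfolding ra_def rb_def \<kappa>_def by (rule order_trans[OF B(1)], rule mult_right_mono[OF \<epsilon>(3)]) simp
    ultimately show ?thesis by simp
  qed
  have s_pos: "0 < s k" if "k < r" for k
    using s_low[OF that] pos by (meson mult_pos_pos order_less_le_trans)
  define \<nu> where "\<nu> = (\<lambda>t k. (\<Sum>j<b. S0 t (gamma j) * V j k) / s k)"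
  show ?thesis
  proof (rule kmeans_recovers_clusters[OF km lab tau size1 _ \<alpha> K])
    show "0 < a" using dims_pos by simp
    show "(4 + 2 * K) * (real r * ((S * real p2 + 1) * \<epsilon> / (\<kappa>\<^sup>2 * ra)))
        < c / (h * (S + 1)) / ((S + 1) * ra)"
    proof -
      have "(4 + 2 * K) * (real r * ((S * real p2 + 1) * \<epsilon> / (\<kappa>\<^sup>2 * ra)))
        = \<epsilon> * ((4 + 2 * K) * (real r * (S * real p2 + 1) / \<kappa>\<^sup>2)) / ra"
        by (simp add: field_simps)
      also have "\<dots> < c / (h * (S + 1)) / (S + 1) / ra"
        using small pos by (intro divide_strict_right_mono) (auto simp: c_def h_def \<kappa>_def)
      finally show ?thesis by simp
    qed
    fix i assume i: "i < a"
    have "\<bar>Uh i k - \<nu> (tau i) k\<bar> \<le> (S * real p2 + 1) * \<epsilon> / (\<kappa>\<^sup>2 * ra)" if k: "k < r" for k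
    proof -
      let ?z = "\<bar>\<Sum>j<b. E i j * V j k\<bar>"
      have k': "k < min a b" using k r by simp
      have "s k * Uh i k = (\<Sum>j<b. (S0 (tau i) (gamma j) + E i j) * V j k)"
        using thin_svd_right[OF svd k' i] Uh i k by simp
      then have "Uh i k - \<nu> (tau i) k = (\<Sum>j<b. E i j * V j k) / s k"
        using s_pos[OF k] by (simp add: \<nu>_def field_simps sum.distrib)
      then have eq: "\<bar>Uh i k - \<nu> (tau i) k\<bar> = ?z / s k" using s_pos[OF k] by simp
      have "s k * ?z \<le> S * real p2 * (\<epsilon> * real b) * sqrt (real a) + B * (sqrt (real b) * L)"
        by (rule noise_projection[OF k' i \<epsilon>(1) L(1) L(2)[OF i] cl[OF i]])
      also have "\<dots> \<le> S * real p2 * (\<epsilon> * (rb * rb)) * ra + \<epsilon> * (ra * rb) * rb"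
        using mult_right_mono[OF B(2), of rb] pos by (simp add: sq(2)[symmetric] ra_def rb_def mult_ac)
      \<comment> \<open>One division by \<open>s k\<close> comes from U = Y V / s, another from s V
        = Y^T U, hence the square of the lower bound.\<close>
      also have "\<dots> = (S * real p2 + 1) * \<epsilon> / (\<kappa>\<^sup>2 * ra) * (\<kappa> * (ra * rb))\<^sup>2"
        using pos by (simp add: field_simps power2_eq_square)
      also have "\<dots> \<le> (S * real p2 + 1) * \<epsilon> / (\<kappa>\<^sup>2 * ra) * (s k)\<^sup>2"
        using pos S \<epsilon> by (intro mult_left_mono power_mono s_low k) auto
      also have "\<dots> = s k * ((S * real p2 + 1) * \<epsilon> / (\<kappa>\<^sup>2 * ra) * s k)"
        by (simp only: power2_eq_square mult_ac)
      finally have "?z \<le> (S * real p2 + 1) * \<epsilon> / (\<kappa>\<^sup>2 * ra) * s k"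
        by (rule mult_left_le_imp_le[OF _ s_pos[OF k]])
      then show ?thesis unfolding eq using s_pos[OF k] by (simp add: pos_divide_le_eq)
    qed
    \<comment> \<open>The factor \<open>real r\<close> arises from bounding the Euclidean norm by
      the sum over coordinates.\<close>
    then have "(\<Sum>k<r. \<bar>Uh i k - \<nu> (tau i) k\<bar>) \<le> (\<Sum>k<r. (S * real p2 + 1) * \<epsilon> / (\<kappa>\<^sup>2 * ra))"
      by (intro sum_mono) auto
    then show "vnorm r (\<lambda>k. Uh i k - \<nu> (tau i) k) \<le> real r * ((S * real p2 + 1) * \<epsilon> / (\<kappa>\<^sup>2 * ra))"
      using order_trans[OF L2_set_le_sum_abs] by simp
  next
    fix t t' assume t: "t < p1" "t' < p1" "t \<noteq> t'"
    let ?A = "\<lambda>j. S0 t (gamma j) - S0 t' (gamma j)"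
    let ?w = "\<lambda>k. \<Sum>j<b. ?A j * V j k"
    let ?x = "vnorm b ?A" and ?v = "vnorm r ?w"
    have x2: "\<alpha> * dm * \<delta>\<^sup>2 * real b \<le> ?x\<^sup>2" and x: "?x \<le> 2 * S * sqrt (real b)"
      using row_difference_norm[OF t(1,2) less_imp_le[OF \<delta>] sep[OF t]] by auto
    have "(2 * c * rb) * rb = \<alpha> * dm * \<delta>\<^sup>2 * real b" by (simp add: c_def sq)
    also note x2
    also have "?x\<^sup>2 \<le> h / ra * ((S + 1) * (ra * rb) * ?v + 2 * B * ?x)"
      unfolding h_def ra_def
      by (rule row_difference_captured[OF t]) (use T in \<open>simp add: ra_def\<close>)
    also have "\<dots> \<le> h / ra * ((S + 1) * (ra * rb) * ?v + 2 * (\<epsilon> * (ra * rb)) * (2 * S * rb))"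
      using B(1) x pos op_bound_nonneg S \<epsilon> by (intro mult_left_mono add_left_mono mult_mono) (auto simp: ra_def rb_def)
    also have "\<dots> = (h * (S + 1) * ?v + \<epsilon> * (4 * S * h) * rb) * rb"
      using pos by (simp add: field_simps)
    finally have "2 * c * rb \<le> h * (S + 1) * ?v + \<epsilon> * (4 * S * h) * rb"
      using pos by simp
    moreover have "\<epsilon> * (4 * S * h) * rb \<le> c * rb"
      using \<epsilon>(4) pos by (intro mult_right_mono) (auto simp: h_def c_def)
    ultimately have "c * rb \<le> h * (S + 1) * ?v" by linarith
    then have v: "c / (h * (S + 1)) * rb \<le> ?v" using pos by (simp add: pos_divide_le_eq mult_ac)
    have "g / (u * ra) = 1 / (u * (ra * rb)) * (g * rb)" for g u
      using pos by simp
    then have "c / (h * (S + 1)) / ((S + 1) * ra) = 1 / ((S + 1) * (ra * rb)) * (c / (h * (S + 1)) * rb)" .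
    also have "\<dots> \<le> 1 / ((S + 1) * (ra * rb)) * ?v"
      using pos by (intro mult_left_mono v) auto
    also have "\<dots> = vnorm r (\<lambda>k. 1 / ((S + 1) * (ra * rb)) * \<bar>?w k\<bar>)"
      using pos by (subst L2_set_right_distrib[symmetric]) (auto simp: L2_set_def)
    \<comment> \<open>Coordinate k of a centre is divided by its own \<open>s k\<close>, so the
      bound passes through the common upper bound of the singular values.\<close>
    also have "\<dots> \<le> vnorm r (\<lambda>k. \<bar>\<nu> t k - \<nu> t' k\<bar>)"
    proof (rule L2_set_mono)
      fix k assume "k \<in> {..<r}"
      then have k: "k < r" by simp
      have "\<bar>\<nu> t k - \<nu> t' k\<bar> = \<bar>?w k\<bar> / s k"
        using s_pos[OF k]
        by (simp add: \<nu>_def diff_divide_distrib[symmetric] sum_subtractf left_diff_distrib)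
      moreover have "\<bar>?w k\<bar> / ((S + 1) * (ra * rb)) \<le> \<bar>?w k\<bar> / s k"
        by (intro divide_left_mono T k mult_pos_pos s_pos pos) simp
      ultimately show "1 / ((S + 1) * (ra * rb)) * \<bar>?w k\<bar> \<le> \<bar>\<nu> t k - \<nu> t' k\<bar>" by simp
      show "0 \<le> 1 / ((S + 1) * (ra * rb)) * \<bar>?w k\<bar>" using pos by simp
    qed
    also have "\<dots> = vnorm r (\<lambda>k. \<nu> t k - \<nu> t' k)" by (simp add: L2_set_def)
    finally show "c / (h * (S + 1)) / ((S + 1) * ra) \<le> vnorm r (\<lambda>k. \<nu> t k - \<nu> t' k)" .
  qed
qed

end

subsection \<open>Random noise\<close>

text \<open>The squared Frobenius norm of E E^T: a polynomial in the entries, so its expectation can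
  be expanded term by term.\<close>

definition gram_norm2 :: "nat \<Rightarrow> nat \<Rightarrow> (nat \<Rightarrow> nat \<Rightarrow> real) \<Rightarrow> real" where
  "gram_norm2 a b E = (\<Sum>i<a. \<Sum>l<a. (\<Sum>j<b. E i j * E l j)\<^sup>2)"

text \<open>With z = E^T x, |z|^2 = x^T (E E^T) x is at most |x|^2 times the Frobenius norm of E
  E^T, by Cauchy-Schwarz in each row.\<close>

lemma bil_le_gram_norm2:
  assumes B: "0 \<le> B" "gram_norm2 a b E \<le> B ^ 4"
  shows "\<bar>bil a b x E y\<bar> \<le> B * vnorm a x * vnorm b y"
proof -
  define G where "G = (\<lambda>i l. \<Sum>j<b. E i j * E l j)"
  define z where "z = (\<lambda>j. \<Sum>i<a. x i * E i j)"
  have "(vnorm b z)\<^sup>2 = (\<Sum>j<b. \<Sum>i<a. \<Sum>l<a. (x i * E i j) * (x l * E l j))"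
    unfolding L2_set_squared by (simp add: z_def power2_eq_square sum_product)
  also have "\<dots> = (\<Sum>i<a. \<Sum>j<b. \<Sum>l<a. (x i * E i j) * (x l * E l j))"
    by (rule sum.swap)
  also have "\<dots> = (\<Sum>i<a. \<Sum>l<a. \<Sum>j<b. (x i * E i j) * (x l * E l j))"
    by (intro sum.cong refl sum.swap)
  also have "\<dots> = (\<Sum>i<a. x i * (\<Sum>l<a. G i l * x l))"
    unfolding G_def by (simp add: sum_distrib_left sum_distrib_right mult_ac)
  also have "\<dots> \<le> vnorm a x * vnorm a (\<lambda>i. \<Sum>l<a. G i l * x l)"
    by (rule abs_le_D1[OF sum_mult_le_L2_set])
  also have "vnorm a (\<lambda>i. \<Sum>l<a. G i l * x l) = vnorm a (\<lambda>i. \<bar>\<Sum>l<a. G i l * x l\<bar>)"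
    by (simp add: L2_set_def)
  also have "\<dots> \<le> vnorm a (\<lambda>i. vnorm a (G i) * vnorm a x)"
    by (intro L2_set_mono sum_mult_le_L2_set) auto
  also have "\<dots> = vnorm a (\<lambda>i. vnorm a (G i)) * vnorm a x"
    by (rule L2_set_left_distrib[symmetric]) simp
  also have "vnorm a (\<lambda>i. vnorm a (G i)) \<le> B\<^sup>2"
  proof -
    have "(vnorm a (\<lambda>i. vnorm a (G i)))\<^sup>2 = gram_norm2 a b E"
      unfolding L2_set_squared gram_norm2_def G_def ..
    also have "\<dots> \<le> (B\<^sup>2)\<^sup>2" using B(2) by (simp flip: power_mult)
    finally show ?thesis by (rule power2_le_imp_le) simp
  qed
  finally have "(vnorm b z)\<^sup>2 \<le> (B * vnorm a x)\<^sup>2"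
    by (simp add: power_mult_distrib mult_left_mono mult_right_mono power2_eq_square mult_ac)
  then have z: "vnorm b z \<le> B * vnorm a x" by (rule power2_le_imp_le) (use B in simp)
  have "bil a b x E y = (\<Sum>j<b. z j * y j)"
    unfolding bil_def z_def sum_distrib_right by (rule sum.swap)
  also have "\<bar>\<dots>\<bar> \<le> vnorm b z * vnorm b y" by (rule sum_mult_le_L2_set)
  also have "\<dots> \<le> B * vnorm a x * vnorm b y" by (intro mult_right_mono z) simp
  finally show ?thesis .
qed

text \<open>A condition on E that mentions no singular vectors and no estimated labels. Cluster sums
  along rows and along columns both occur because recovery is run on Y and on its transpose.\<close>

definition tame_noise :: "nat \<Rightarrow> nat \<Rightarrow> nat \<Rightarrow> nat \<Rightarrow> (nat \<Rightarrow> nat) \<Rightarrow> (nat \<Rightarrow> nat) \<Rightarrow>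
    real \<Rightarrow> real \<Rightarrow> real \<Rightarrow> (nat \<Rightarrow> nat \<Rightarrow> real) \<Rightarrow> bool" where
  "tame_noise a b p1 p2 tau gamma L \<theta> \<epsilon> E \<longleftrightarrow>
     (\<forall>i<a. \<forall>j<b. \<bar>E i j\<bar> \<le> L) \<and> gram_norm2 a b E \<le> \<theta> \<and>
     (\<forall>i<a. \<forall>t<p2. \<bar>\<Sum>j | j < b \<and> gamma j = t. E i j\<bar> \<le> \<epsilon> * real b) \<and>
     (\<forall>j<b. \<forall>s<p1. \<bar>\<Sum>i | i < a \<and> tau i = s. E i j\<bar> \<le> \<epsilon> * real a)"

lemma bil_transpose: "bil b a y (\<lambda>j i. E i j) x = bil a b x E y"
  unfolding bil_def by (subst sum.swap) (simp add: mult_ac)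

section \<open>Concentration of sub-Gaussian sums\<close>

context prob_space
begin

text \<open>Exponential Markov inequality. As t may have either sign, it serves both tails; N
  replaces the cardinality because cluster sizes are later bounded by the full dimension.\<close>

lemma chernoff_sum:
  fixes X :: "'i \<Rightarrow> 'a \<Rightarrow> real"
  assumes J: "finite J" "indep_vars (\<lambda>_. borel) X J" "real (card J) \<le> N" and c: "0 \<le> c"
    and int: "\<And>j. j \<in> J \<Longrightarrow> integrable M (\<lambda>x. exp (t * X j x))"
    and mgf: "\<And>j. j \<in> J \<Longrightarrow> expectation (\<lambda>x. exp (t * X j x)) \<le> exp (c * t\<^sup>2)"
  shows "prob {x \<in> space M. v \<le> t * (\<Sum>j\<in>J. X j x)} \<le> exp (c * t\<^sup>2 * N - v)"
proof -
  let ?Y = "\<lambda>j x. exp (t * X j x)"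
  have ind: "indep_vars (\<lambda>_. borel) ?Y J"
    by (rule indep_vars_compose2[OF J(2), where Y = "\<lambda>_ y. exp (t * y)"]) simp
  have intp: "integrable M (\<lambda>x. \<Prod>j\<in>J. ?Y j x)"
    by (rule indep_vars_integrable[OF J(1) ind int])
  have "prob {x \<in> space M. v \<le> t * (\<Sum>j\<in>J. X j x)} = prob {x \<in> space M. exp v \<le> (\<Prod>j\<in>J. ?Y j x)}"
    using J(1) by (simp add: exp_sum[symmetric] sum_distrib_left)
  also have "\<dots> \<le> expectation (\<lambda>x. \<Prod>j\<in>J. ?Y j x) / exp v"
    by (rule integral_Markov_inequality_measure[OF intp, where A = "{}"]) (auto intro!: prod_nonneg)
  also have "expectation (\<lambda>x. \<Prod>j\<in>J. ?Y j x) = (\<Prod>j\<in>J. expectation (?Y j))"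
    by (rule indep_vars_lebesgue_integral[OF J(1) ind int])
  also have "\<dots> \<le> (\<Prod>j\<in>J. exp (c * t\<^sup>2))"
    by (intro prod_mono conjI mgf integral_nonneg) auto
  also have "\<dots> = exp (real (card J) * (c * t\<^sup>2))"
    by (simp add: exp_of_nat_mult)
  also have "\<dots> \<le> exp (N * (c * t\<^sup>2))"
    using J(3) c by (simp add: mult_right_mono)
  finally show ?thesis
    by (simp add: exp_diff divide_right_mono mult_ac)
qed

lemma subgaussian_sum_tail:
  fixes X :: "'i \<Rightarrow> 'a \<Rightarrow> real"
  assumes J: "finite J" "indep_vars (\<lambda>_. borel) X J" "real (card J) \<le> N" and c: "0 < c" "0 < N"
    and int: "\<And>j t. j \<in> J \<Longrightarrow> integrable M (\<lambda>x. exp (t * X j x))"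
    and mgf: "\<And>j t. j \<in> J \<Longrightarrow> expectation (\<lambda>x. exp (t * X j x)) \<le> exp (c * t\<^sup>2)"
    and u: "0 \<le> u"
  shows "prob {x \<in> space M. u < \<bar>\<Sum>j\<in>J. X j x\<bar>} \<le> 2 * exp (- (u\<^sup>2 / (4 * c * N)))"
proof -
  \<comment> \<open>This t minimises c t^2 N - t u, with minimum - u^2 / (4 c N).\<close>
  define t where "t = u / (2 * c * N)"
  have t: "0 \<le> t" using c u by (simp add: t_def)
  have rv: "X j \<in> borel_measurable M" if "j \<in> J" for j
    using J(2) that unfolding indep_vars_def2 by blast
  have ev: "c * t\<^sup>2 * N - t * u = - (u\<^sup>2 / (4 * c * N))"
    using c by (simp add: t_def field_simps power2_eq_square)
  let ?S = "\<lambda>x. \<Sum>j\<in>J. X j x"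
  have [measurable]: "?S \<in> borel_measurable M" by (intro borel_measurable_sum rv)
  have "prob {x \<in> space M. u < \<bar>?S x\<bar>}
      \<le> prob ({x \<in> space M. t * u \<le> t * ?S x} \<union> {x \<in> space M. t * u \<le> - t * ?S x})"
  proof (rule finite_measure_mono)
    show "{x \<in> space M. u < \<bar>?S x\<bar>} \<subseteq>
      {x \<in> space M. t * u \<le> t * ?S x} \<union> {x \<in> space M. t * u \<le> - t * ?S x}"
    proof
      fix x assume "x \<in> {x \<in> space M. u < \<bar>?S x\<bar>}"
      then have "x \<in> space M" "u \<le> ?S x \<or> u \<le> - ?S x" by auto
      then show "x \<in> {x \<in> space M. t * u \<le> t * ?S x} \<union> {x \<in> space M. t * u \<le> - t * ?S x}"
        using mult_left_mono[OF _ t, of u "?S x"] mult_left_mono[OF _ t, of u "- ?S x"] by auto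
    qed
  qed measurable
  also have "\<dots> \<le> prob {x \<in> space M. t * u \<le> t * ?S x} + prob {x \<in> space M. t * u \<le> - t * ?S x}"
    by (rule measure_Un_le) measurable
  also have "prob {x \<in> space M. t * u \<le> t * ?S x} \<le> exp (c * t\<^sup>2 * N - t * u)"
    by (rule chernoff_sum[OF J less_imp_le[OF c(1)] int mgf])
  also have "prob {x \<in> space M. t * u \<le> - t * ?S x} \<le> exp (c * (- t)\<^sup>2 * N - t * u)"
    by (rule chernoff_sum[OF J less_imp_le[OF c(1)] int mgf])
  finally show ?thesis by (simp add: ev)
qed

end

text \<open>Repeated use of |x y| \<le> (x^2 + y^2) / 2. It dominates products of four entries
  whatever coincidences there are among them.\<close>

lemma abs_mult4_le:
  fixes p q u v :: real
  shows "\<bar>p * q * u * v\<bar> \<le> (p ^ 4 + q ^ 4 + u ^ 4 + v ^ 4) / 4"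
proof -
  have am: "\<bar>x * y\<bar> \<le> (x\<^sup>2 + y\<^sup>2) / 2" for x y :: real
    using sum_squares_bound[of "\<bar>x\<bar>" "\<bar>y\<bar>"] by (simp add: abs_mult)
  have "\<bar>p * q * u * v\<bar> = \<bar>(p * q) * (u * v)\<bar>" by (simp add: mult.assoc)
  also have "\<dots> \<le> ((p * q)\<^sup>2 + (u * v)\<^sup>2) / 2" by (rule am)
  also have "(p * q)\<^sup>2 \<le> (p ^ 4 + q ^ 4) / 2"
    using am[of "p\<^sup>2" "q\<^sup>2"] by (simp add: power_mult_distrib flip: power_mult)
  also have "(u * v)\<^sup>2 \<le> (u ^ 4 + v ^ 4) / 2"
    using am[of "u\<^sup>2" "v\<^sup>2"] by (simp add: power_mult_distrib flip: power_mult)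
  finally show ?thesis by (simp add: add_divide_distrib)
qed

context prob_space
begin

text \<open>Expanding the square gives products of the entries at the corners of a rectangle with
  rows i, l and columns j, j'. If it is nondegenerate, the corners are independent and centred and
  the mean vanishes. What survives are a b^2 terms with i = l and a^2 b terms with j = j', each of
  mean at most \<kappa>.\<close>

lemma gram_norm2_moment:
  fixes E :: "nat \<Rightarrow> nat \<Rightarrow> 'a \<Rightarrow> real"
  assumes indep: "indep_vars (\<lambda>_. borel) (\<lambda>(i, j). E i j) ({..<a} \<times> {..<b})"
    and int1: "\<And>i j. i < a \<Longrightarrow> j < b \<Longrightarrow> integrable M (E i j)"
    and mean: "\<And>i j. i < a \<Longrightarrow> j < b \<Longrightarrow> expectation (E i j) = 0"
    and int4: "\<And>i j. i < a \<Longrightarrow> j < b \<Longrightarrow> integrable M (\<lambda>x. E i j x ^ 4)"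
    and mom4: "\<And>i j. i < a \<Longrightarrow> j < b \<Longrightarrow> expectation (\<lambda>x. E i j x ^ 4) = \<kappa>"
  shows "integrable M (\<lambda>x. gram_norm2 a b (\<lambda>i j. E i j x))"
    and "expectation (\<lambda>x. gram_norm2 a b (\<lambda>i j. E i j x)) \<le> \<kappa> * (real a * (real b)\<^sup>2 + (real a)\<^sup>2 * real b)"
proof -
  let ?Q = "\<lambda>i l j j' x. E i j x * E l j x * E i j' x * E l j' x"
  have rv: "E i j \<in> borel_measurable M" if "i < a" "j < b" for i j
    using int1[OF that] by simp
  have gram: "gram_norm2 a b (\<lambda>i j. E i j x) = (\<Sum>i<a. \<Sum>l<a. \<Sum>j<b. \<Sum>j'<b. ?Q i l j j' x)" for x
    unfolding gram_norm2_def power2_eq_square sum_product by (simp add: mult_ac)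
  have int: "integrable M (?Q i l j j')" and le: "expectation (?Q i l j j') \<le> \<kappa>"
    if "i < a" "l < a" "j < b" "j' < b" for i l j j'
  proof -
    let ?b = "\<lambda>x. (E i j x ^ 4 + E l j x ^ 4 + E i j' x ^ 4 + E l j' x ^ 4) / 4"
    have ib: "integrable M ?b" using int4 that by simp
    show iQ: "integrable M (?Q i l j j')"
      by (rule Bochner_Integration.integrable_bound[OF ib])
        (use rv that abs_mult4_le in \<open>auto intro!: AE_I2 borel_measurable_times intro: order_trans[OF _ abs_ge_self]\<close>)
    have "expectation (?Q i l j j') \<le> expectation ?b"
      by (rule integral_mono[OF iQ ib]) (rule abs_le_D1[OF abs_mult4_le])
    also have "\<dots> = \<kappa>" using that by (simp add: int4 mom4)
    finally show "expectation (?Q i l j j') \<le> \<kappa>" .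
  qed
  have zero: "expectation (?Q i l j j') = 0"
    if "i < a" "l < a" "j < b" "j' < b" "i \<noteq> l" "j \<noteq> j'" for i l j j'
  proof -
    let ?K = "{(i, j), (l, j), (i, j'), (l, j')}"
    have K: "indep_vars (\<lambda>_. borel) (\<lambda>(i, j). E i j) ?K"
      by (rule indep_vars_subset[OF indep]) (use that in auto)
    have "?Q i l j j' = (\<lambda>x. \<Prod>k\<in>?K. (case k of (i, j) \<Rightarrow> E i j) x)"
      using that by (auto simp: mult_ac)
    then have "expectation (?Q i l j j') = expectation (\<lambda>x. \<Prod>k\<in>?K. (case k of (i, j) \<Rightarrow> E i j) x)"
      by (rule arg_cong)
    also have "\<dots> = (\<Prod>k\<in>?K. expectation (case k of (i, j) \<Rightarrow> E i j))"
      by (rule indep_vars_lebesgue_integral[OF _ K]) (use that int1 in auto)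
    also have "\<dots> = 0" using that mean by (simp add: prod_zero_iff)
    finally show ?thesis .
  qed
  show "integrable M (\<lambda>x. gram_norm2 a b (\<lambda>i j. E i j x))"
    unfolding gram by (intro Bochner_Integration.integrable_sum int) auto
  have "expectation (\<lambda>x. gram_norm2 a b (\<lambda>i j. E i j x))
      = (\<Sum>i<a. \<Sum>l<a. \<Sum>j<b. \<Sum>j'<b. expectation (?Q i l j j'))"
    unfolding gram
    by (subst Bochner_Integration.integral_sum, force intro!: Bochner_Integration.integrable_sum int,
        rule sum.cong[OF refl])+ (rule refl)
  \<comment> \<open>Terms with both i = l and j = j' are counted twice, harmless as \<kappa> \<ge>
    0.\<close>
  also have "\<dots> \<le> (\<Sum>i<a. \<Sum>l<a. \<Sum>j<b. \<Sum>j'<b. (if i = l then \<kappa> else 0) + (if j = j' then \<kappa> else 0))"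
  proof (intro sum_mono)
    fix i l j j' assume *: "i \<in> {..<a}" "l \<in> {..<a}" "j \<in> {..<b}" "j' \<in> {..<b}"
    have m: "expectation (\<lambda>x. E i j x ^ 4) = \<kappa>" using mom4[of i j] * by simp
    have "0 \<le> \<kappa>" unfolding m[symmetric] by (rule Bochner_Integration.integral_nonneg) simp
    then show "expectation (?Q i l j j') \<le> (if i = l then \<kappa> else 0) + (if j = j' then \<kappa> else 0)"
      using le[of i l j j'] zero[of i l j j'] * by auto
  qed
  also have "\<dots> = \<kappa> * (real a * (real b)\<^sup>2 + (real a)\<^sup>2 * real b)"
    by (simp add: sum.distrib flip: sum_distrib_left) (simp add: power2_eq_square algebra_simps)
  finally show "expectation (\<lambda>x. gram_norm2 a b (\<lambda>i j. E i j x))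
      \<le> \<kappa> * (real a * (real b)\<^sup>2 + (real a)\<^sup>2 * real b)" .
qed

text \<open>Union bound over the four defining conditions: Markov's inequality for
  \<open>gram_norm2\<close>, sub-Gaussian tails for entries and cluster sums.\<close>

lemma tame_noise_prob:
  fixes E :: "nat \<Rightarrow> nat \<Rightarrow> 'a \<Rightarrow> real" and tau gamma :: "nat \<Rightarrow> nat" and p1 p2 :: nat
  assumes indep: "indep_vars (\<lambda>_. borel) (\<lambda>(i, j). E i j) ({..<a} \<times> {..<b})"
    and int1: "\<And>i j. i < a \<Longrightarrow> j < b \<Longrightarrow> integrable M (E i j)"
    and mean: "\<And>i j. i < a \<Longrightarrow> j < b \<Longrightarrow> expectation (E i j) = 0"
    and int4: "\<And>i j. i < a \<Longrightarrow> j < b \<Longrightarrow> integrable M (\<lambda>x. E i j x ^ 4)"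
    and mom4: "\<And>i j. i < a \<Longrightarrow> j < b \<Longrightarrow> expectation (\<lambda>x. E i j x ^ 4) = \<kappa>"
    and c: "0 < c"
    and inte: "\<And>i j t. i < a \<Longrightarrow> j < b \<Longrightarrow> integrable M (\<lambda>x. exp (t * E i j x))"
    and mgf: "\<And>i j t. i < a \<Longrightarrow> j < b \<Longrightarrow> expectation (\<lambda>x. exp (t * E i j x)) \<le> exp (c * t\<^sup>2)"
    and pos: "0 < a" "0 < b" "0 \<le> L" "0 < \<theta>" "0 \<le> \<epsilon>"
  defines "A \<equiv> {x \<in> space M. tame_noise a b p1 p2 tau gamma L \<theta> \<epsilon> (\<lambda>i j. E i j x)}"
  shows "A \<in> events"
    and "1 - prob A \<le> real a * real b * (2 * exp (- (L\<^sup>2 / (4 * c))))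
      + \<kappa> * (real a * (real b)\<^sup>2 + (real a)\<^sup>2 * real b) / \<theta>
      + real a * real p2 * (2 * exp (- (\<epsilon>\<^sup>2 * real b / (4 * c))))
      + real b * real p1 * (2 * exp (- (\<epsilon>\<^sup>2 * real a / (4 * c))))"
proof -
  have rv: "E i j \<in> borel_measurable M" if "i < a" "j < b" for i j
    using int1[OF that] by simp
  define F where "F = (\<lambda>x. gram_norm2 a b (\<lambda>i j. E i j x))"
  define D1 where "D1 = (\<lambda>(i, j). {x \<in> space M. L < \<bar>E i j x\<bar>})"
  \<comment> \<open>The weak inequality is the one in Markov's inequality; it covers every failure
    of the bound.\<close>
  define D2 where "D2 = {x \<in> space M. \<theta> \<le> F x}"
  define D3 where "D3 = (\<lambda>(i, t). {x \<in> space M. \<epsilon> * real b < \<bar>\<Sum>j | j < b \<and> gamma j = t. E i j x\<bar>})"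
  define D4 where "D4 = (\<lambda>(j, s). {x \<in> space M. \<epsilon> * real a < \<bar>\<Sum>i | i < a \<and> tau i = s. E i j x\<bar>})"
  have F[measurable]: "F \<in> borel_measurable M"
    unfolding F_def gram_norm2_def
    by (intro borel_measurable_sum borel_measurable_power borel_measurable_times rv) auto
  have S3: "(\<lambda>x. \<Sum>j | j < b \<and> gamma j = t. E i j x) \<in> borel_measurable M" if "i < a" for i t
    by (intro borel_measurable_sum rv that) auto
  have S4: "(\<lambda>x. \<Sum>i | i < a \<and> tau i = s. E i j x) \<in> borel_measurable M" if "j < b" for j s
    by (intro borel_measurable_sum rv that) auto
  have m1: "D1 k \<in> events" if "k \<in> {..<a} \<times> {..<b}" for k
    using that rv unfolding D1_def by (auto split: prod.splits)
  have m2: "D2 \<in> events" unfolding D2_def by measurable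
  have m3: "D3 k \<in> events" if "k \<in> {..<a} \<times> {..<p2}" for k
    using that S3 unfolding D3_def by (auto split: prod.splits)
  have m4: "D4 k \<in> events" if "k \<in> {..<b} \<times> {..<p1}" for k
    using that S4 unfolding D4_def by (auto split: prod.splits)
  show A: "A \<in> events"
  proof -
    have "A = {x \<in> space M. (\<forall>i\<in>{..<a}. \<forall>j\<in>{..<b}. \<bar>E i j x\<bar> \<le> L) \<and> F x \<le> \<theta> \<and>
     (\<forall>i\<in>{..<a}. \<forall>t\<in>{..<p2}. \<bar>\<Sum>j | j < b \<and> gamma j = t. E i j x\<bar> \<le> \<epsilon> * real b) \<and>
     (\<forall>j\<in>{..<b}. \<forall>s\<in>{..<p1}. \<bar>\<Sum>i | i < a \<and> tau i = s. E i j x\<bar> \<le> \<epsilon> * real a)}"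
      unfolding A_def tame_noise_def F_def by auto
    also have "\<dots> \<in> events"
      by (intro sets.sets_Collect_conj sets.sets_Collect_finite_All finite_lessThan
          borel_measurable_le borel_measurable_abs borel_measurable_const rv S3 S4 F) auto
    finally show ?thesis .
  qed
  let ?D1 = "\<Union>k\<in>{..<a} \<times> {..<b}. D1 k" and ?D3 = "\<Union>k\<in>{..<a} \<times> {..<p2}. D3 k"
    and ?D4 = "\<Union>k\<in>{..<b} \<times> {..<p1}. D4 k"
  have u1: "?D1 \<in> events" and u3: "?D3 \<in> events" and u4: "?D4 \<in> events"
    using m1 m3 m4 by (auto intro!: sets.finite_UN)
  have "1 - prob A = prob (space M - A)" using prob_compl[OF A] by simp
  also have "\<dots> \<le> prob (?D1 \<union> D2 \<union> ?D3 \<union> ?D4)"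
  proof (rule finite_measure_mono)
    show "space M - A \<subseteq> ?D1 \<union> D2 \<union> ?D3 \<union> ?D4"
    proof (rule subsetI, rule ccontr)
      fix x assume x: "x \<in> space M - A" "x \<notin> ?D1 \<union> D2 \<union> ?D3 \<union> ?D4"
      then have xs: "x \<in> space M" by simp
      have "\<bar>E i j x\<bar> \<le> L" if "i < a" "j < b" for i j
      proof -
        have "x \<notin> D1 (i, j)" using x(2) that by blast
        then show ?thesis using xs by (simp add: D1_def)
      qed
      moreover have "gram_norm2 a b (\<lambda>i j. E i j x) \<le> \<theta>"
        using x(2) xs by (simp add: D2_def F_def)
      moreover have "\<bar>\<Sum>j | j < b \<and> gamma j = t. E i j x\<bar> \<le> \<epsilon> * real b" if "i < a" "t < p2" for i t
      proof -
        have "x \<notin> D3 (i, t)" using x(2) that by blast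
        then show ?thesis using xs by (simp add: D3_def)
      qed
      moreover have "\<bar>\<Sum>i | i < a \<and> tau i = s. E i j x\<bar> \<le> \<epsilon> * real a" if "j < b" "s < p1" for j s
      proof -
        have "x \<notin> D4 (j, s)" using x(2) that by blast
        then show ?thesis using xs by (simp add: D4_def)
      qed
      ultimately have "x \<in> A" using xs unfolding A_def tame_noise_def by simp
      then show False using x(1) by simp
    qed
  qed (use u1 u3 u4 m2 in auto)
  also have "\<dots> \<le> prob ?D1 + prob D2 + prob ?D3 + prob ?D4"
    using measure_Un_le[of "?D1 \<union> D2 \<union> ?D3" M ?D4] measure_Un_le[of "?D1 \<union> D2" M ?D3]
      measure_Un_le[of ?D1 M D2] u1 u3 u4 m2 by auto
  also have "prob ?D1 \<le> (\<Sum>k\<in>{..<a} \<times> {..<b}. prob (D1 k))"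
    by (rule finite_measure_subadditive_finite) (use m1 in auto)
  also have "\<dots> \<le> (\<Sum>k\<in>{..<a} \<times> {..<b}. 2 * exp (- (L\<^sup>2 / (4 * c))))"
  proof (rule sum_mono)
    fix k assume k: "k \<in> {..<a} \<times> {..<b}"
    obtain i j where ij: "k = (i, j)" "i < a" "j < b" using k by auto
    have "prob {x \<in> space M. L < \<bar>\<Sum>k\<in>{k}. (case k of (i, j) \<Rightarrow> E i j) x\<bar>} \<le> 2 * exp (- (L\<^sup>2 / (4 * c * 1)))"
      by (rule subgaussian_sum_tail[OF _ indep_vars_subset[OF indep]]) (use k c inte mgf pos in auto)
    then show "prob (D1 k) \<le> 2 * exp (- (L\<^sup>2 / (4 * c)))" using ij by (simp add: D1_def)
  qed
  also have "\<dots> = real a * real b * (2 * exp (- (L\<^sup>2 / (4 * c))))" by simp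
  also have "prob D2 \<le> expectation F / \<theta>"
    unfolding D2_def
    by (rule integral_Markov_inequality_measure[where A = "{}"])
      (use gram_norm2_moment(1)[OF indep int1 mean int4 mom4] pos in \<open>auto simp: F_def gram_norm2_def intro!: sum_nonneg\<close>)
  also have "\<dots> \<le> \<kappa> * (real a * (real b)\<^sup>2 + (real a)\<^sup>2 * real b) / \<theta>"
    unfolding F_def using gram_norm2_moment(2)[OF indep int1 mean int4 mom4] pos
    by (intro divide_right_mono) auto
  also have "prob ?D3 \<le> (\<Sum>k\<in>{..<a} \<times> {..<p2}. prob (D3 k))"
    by (rule finite_measure_subadditive_finite) (use m3 in auto)
  also have "\<dots> \<le> (\<Sum>k\<in>{..<a} \<times> {..<p2}. 2 * exp (- (\<epsilon>\<^sup>2 * real b / (4 * c))))"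
  proof (rule sum_mono)
    fix k assume k: "k \<in> {..<a} \<times> {..<p2}"
    obtain i t where it: "k = (i, t)" "i < a" using k by auto
    \<comment> \<open>Row i within one column cluster, as positions in the matrix: at most b of
      them, hence N = b in the tail bound.\<close>
    let ?J = "{i} \<times> {j. j < b \<and> gamma j = t}"
    have card: "card ?J \<le> b"
      using card_mono[of "{..<b}" "{j. j < b \<and> gamma j = t}"] by (auto simp: card_cartesian_product)
    have "prob {x \<in> space M. \<epsilon> * real b < \<bar>\<Sum>k\<in>?J. (case k of (i, j) \<Rightarrow> E i j) x\<bar>}
        \<le> 2 * exp (- ((\<epsilon> * real b)\<^sup>2 / (4 * c * real b)))"
      by (rule subgaussian_sum_tail[OF _ indep_vars_subset[OF indep]]) (use it card c inte mgf pos in auto)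
    moreover have "(\<Sum>k\<in>?J. (case k of (i, j) \<Rightarrow> E i j) x) = (\<Sum>j | j < b \<and> gamma j = t. E i j x)" for x
      using sum.cartesian_product[of "\<lambda>i j. E i j x" "{j. j < b \<and> gamma j = t}" "{i}"]
      by (simp add: case_prod_beta')
    moreover have "(\<epsilon> * real b)\<^sup>2 / (4 * c * real b) = \<epsilon>\<^sup>2 * real b / (4 * c)"
      using pos by (simp add: power2_eq_square)
    ultimately show "prob (D3 k) \<le> 2 * exp (- (\<epsilon>\<^sup>2 * real b / (4 * c)))" using it by (simp add: D3_def)
  qed
  also have "\<dots> = real a * real p2 * (2 * exp (- (\<epsilon>\<^sup>2 * real b / (4 * c))))" by simp
  also have "prob ?D4 \<le> (\<Sum>k\<in>{..<b} \<times> {..<p1}. prob (D4 k))"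
    by (rule finite_measure_subadditive_finite) (use m4 in auto)
  also have "\<dots> \<le> (\<Sum>k\<in>{..<b} \<times> {..<p1}. 2 * exp (- (\<epsilon>\<^sup>2 * real a / (4 * c))))"
  proof (rule sum_mono)
    fix k assume k: "k \<in> {..<b} \<times> {..<p1}"
    obtain j s where js: "k = (j, s)" "j < b" using k by auto
    let ?J = "{i. i < a \<and> tau i = s} \<times> {j}"
    have card: "card ?J \<le> a"
      using card_mono[of "{..<a}" "{i. i < a \<and> tau i = s}"] by (auto simp: card_cartesian_product)
    have "prob {x \<in> space M. \<epsilon> * real a < \<bar>\<Sum>k\<in>?J. (case k of (i, j) \<Rightarrow> E i j) x\<bar>}
        \<le> 2 * exp (- ((\<epsilon> * real a)\<^sup>2 / (4 * c * real a)))"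
      by (rule subgaussian_sum_tail[OF _ indep_vars_subset[OF indep]]) (use js card c inte mgf pos in auto)
    moreover have "(\<Sum>k\<in>?J. (case k of (i, j) \<Rightarrow> E i j) x) = (\<Sum>i | i < a \<and> tau i = s. E i j x)" for x
      using sum.cartesian_product[of "\<lambda>i j. E i j x" "{j}" "{i. i < a \<and> tau i = s}"]
      by (simp add: case_prod_beta')
    moreover have "(\<epsilon> * real a)\<^sup>2 / (4 * c * real a) = \<epsilon>\<^sup>2 * real a / (4 * c)"
      using pos by (simp add: power2_eq_square)
    ultimately show "prob (D4 k) \<le> 2 * exp (- (\<epsilon>\<^sup>2 * real a / (4 * c)))" using js by (simp add: D4_def)
  qed
  also have "\<dots> = real b * real p1 * (2 * exp (- (\<epsilon>\<^sup>2 * real a / (4 * c))))" by simp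
  finally show "1 - prob A \<le> real a * real b * (2 * exp (- (L\<^sup>2 / (4 * c))))
      + \<kappa> * (real a * (real b)\<^sup>2 + (real a)\<^sup>2 * real b) / \<theta>
      + real a * real p2 * (2 * exp (- (\<epsilon>\<^sup>2 * real b / (4 * c))))
      + real b * real p1 * (2 * exp (- (\<epsilon>\<^sup>2 * real a / (4 * c))))" by simp
qed

end

subsection \<open>Strong consistency\<close>

lemma finite_positive_lower_bound:
  fixes f :: "nat \<Rightarrow> real"
  assumes "\<forall>s<p. 0 < f s"
  shows "\<exists>e>0. \<forall>s<p. e \<le> f s"
  using assms
proof (induction p)
  case 0
  then show ?case by (auto intro: exI[of _ 1])
next
  case (Suc p)
  then obtain e where "e > 0" "\<forall>s<p. e \<le> f s" by auto
  then show ?case using Suc.prems by (intro exI[of _ "min e (f p)"]) (auto simp: less_Suc_eq)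
qed

text \<open>The threshold covers all smaller x too, so that several conditions can be met by the
  minimum of their thresholds.\<close>

lemma small_multiplier:
  fixes A C :: real
  assumes "0 \<le> A" "0 < C"
  shows "\<exists>e>0. \<forall>x. 0 < x \<longrightarrow> x \<le> e \<longrightarrow> x * A < C"
proof (intro exI[of _ "C / (A + 1)"] conjI allI impI)
  show "0 < C / (A + 1)" using assms by simp
  fix x assume x: "0 < x" "x \<le> C / (A + 1)"
  then have "x * (A + 1) \<le> C" using assms by (simp add: pos_le_divide_eq)
  then show "x * A < C" using x by (simp add: algebra_simps)
qed

lemma small_multiplier4:
  fixes A1 A2 A3 C1 C2 C3 C :: real
  assumes "0 \<le> A1" "0 < C1" "0 \<le> A2" "0 < C2" "0 \<le> A3" "0 < C3" "0 < C"
  shows "\<exists>x>0. x \<le> C \<and> x * A1 < C1 \<and> x * A2 < C2 \<and> x * A3 < C3"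
proof -
  obtain e1 e2 e3 where "e1 > 0" "e2 > 0" "e3 > 0"
    "\<forall>x. 0 < x \<longrightarrow> x \<le> e1 \<longrightarrow> x * A1 < C1"
    "\<forall>x. 0 < x \<longrightarrow> x \<le> e2 \<longrightarrow> x * A2 < C2"
    "\<forall>x. 0 < x \<longrightarrow> x \<le> e3 \<longrightarrow> x * A3 < C3"
    using small_multiplier[OF assms(1,2)] small_multiplier[OF assms(3,4)] small_multiplier[OF assms(5,6)]
    by blast
  then show ?thesis using assms by (intro exI[of _ "min C (min e1 (min e2 e3))"]) auto
qed

text \<open>From y \<le> exp y at y = |x| / 4, raised to the fourth power; 256 = 4^4.\<close>

lemma power4_le_exp: "(x::real) ^ 4 \<le> 256 * (exp x + exp (- x))"
proof -
  have "\<bar>x\<bar> / 4 \<le> exp (\<bar>x\<bar> / 4)" using exp_ge_add_one_self[of "\<bar>x\<bar> / 4"] by linarith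
  then have "(\<bar>x\<bar> / 4) ^ 4 \<le> exp (\<bar>x\<bar> / 4) ^ 4" by (intro power_mono) auto
  also have "\<dots> = exp \<bar>x\<bar>" by (simp flip: exp_of_nat_mult)
  also have "\<dots> \<le> exp x + exp (- x)" by (cases "x \<ge> 0") auto
  finally show ?thesis by (simp add: power_divide)
qed

text \<open>Moments are transported along the common distribution \<mu>; the fourth is finite
  because x^4 is dominated by the exponentials at t = 1 and t = -1.\<close>

lemma (in prob_space) subgaussian_moments:
  fixes \<mu> :: "real measure"
  assumes X: "X \<in> borel_measurable M" "distr M borel X = \<mu>"
    and mean: "integrable \<mu> (\<lambda>x. x)" "(\<integral>x. x \<partial>\<mu>) = 0"
    and sub: "\<And>t. integrable \<mu> (\<lambda>x. exp (t * x))" "\<And>t. (\<integral>x. exp (t * x) \<partial>\<mu>) \<le> exp (c * t\<^sup>2)"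
  shows "integrable M X" "expectation X = 0"
    "\<And>t. integrable M (\<lambda>x. exp (t * X x))" "\<And>t. expectation (\<lambda>x. exp (t * X x)) \<le> exp (c * t\<^sup>2)"
    "integrable M (\<lambda>x. X x ^ 4)" "expectation (\<lambda>x. X x ^ 4) = (\<integral>x. x ^ 4 \<partial>\<mu>)"
proof -
  have eq: "integrable \<mu> f \<longleftrightarrow> integrable M (\<lambda>x. f (X x))" "(\<integral>x. f x \<partial>\<mu>) = expectation (\<lambda>x. f (X x))"
    if "f \<in> borel_measurable borel" for f :: "real \<Rightarrow> real"
    unfolding X(2)[symmetric] by (rule integrable_distr_eq[OF X(1) that], rule integral_distr[OF X(1) that])
  show "integrable M X" using mean(1) eq(1)[OF measurable_ident_sets[OF refl]] by simp
  show "expectation X = 0" using mean(2) eq(2)[OF measurable_ident_sets[OF refl]] by simp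
  have exp_meas: "(\<lambda>x. exp (t * x)) \<in> borel_measurable borel" for t :: real by measurable
  show exp: "integrable M (\<lambda>x. exp (t * X x))" for t
    using sub(1)[of t] unfolding eq(1)[OF exp_meas] .
  show "expectation (\<lambda>x. exp (t * X x)) \<le> exp (c * t\<^sup>2)" for t
    using sub(2)[of t] unfolding eq(2)[OF exp_meas] .
  have "integrable M (\<lambda>x. 256 * (exp (X x) + exp (- X x)))"
    using exp[of 1] exp[of "-1"] by simp
  then show "integrable M (\<lambda>x. X x ^ 4)"
  proof (rule Bochner_Integration.integrable_bound)
    show "(\<lambda>x. X x ^ 4) \<in> borel_measurable M" using X(1) by simp
    have "norm (X x ^ 4) \<le> norm (256 * (exp (X x) + exp (- X x)))" for x
      using power4_le_exp[of "X x"] by simp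
    then show "AE x in M. norm (X x ^ 4) \<le> norm (256 * (exp (X x) + exp (- X x)))" by simp
  qed
  show "expectation (\<lambda>x. X x ^ 4) = (\<integral>x. x ^ 4 \<partial>\<mu>)" 
    by (rule eq(2)[symmetric]) measurable
qed

text \<open>The coefficient 8 c lets a single entry exceed L with probability at most 2 / (m n)^2,
  against m n entries; the summand 1 keeps L at least 1. The operator norm term equals (\<kappa> /
  \<epsilon>^4) (L^4 / m + L^4 / n), and L^2 / sqrt(m) tends to 0 by ln n = o(sqrt m), as ln m /
  sqrt(m) vanishes by itself.\<close>

lemma tame_noise_failure_tendsto_0:
  fixes m n :: "nat \<Rightarrow> nat" and c \<epsilon> \<kappa> :: real and p1 p2 :: nat
  assumes min_lim: "filterlim (\<lambda>k. min (m k) (n k)) at_top sequentially"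
    and rate1: "(\<lambda>k. ln (real (m k))) \<in> o(\<lambda>k. sqrt (real (n k)))"
    and rate2: "(\<lambda>k. ln (real (n k))) \<in> o(\<lambda>k. sqrt (real (m k)))"
    and c: "0 < c" and \<epsilon>: "0 < \<epsilon>"
  defines "L \<equiv> \<lambda>k. sqrt (1 + 8 * c * (ln (real (m k)) + ln (real (n k))))"
  shows "(\<lambda>k. real (m k) * real (n k) * (2 * exp (- ((L k)\<^sup>2 / (4 * c))))
      + \<kappa> * (real (m k) * (real (n k))\<^sup>2 + (real (m k))\<^sup>2 * real (n k)) / (\<epsilon> / L k * (sqrt (real (m k)) * sqrt (real (n k)))) ^ 4
      + real (m k) * real p2 * (2 * exp (- (\<epsilon>\<^sup>2 * real (n k) / (4 * c))))
      + real (n k) * real p1 * (2 * exp (- (\<epsilon>\<^sup>2 * real (m k) / (4 * c))))) \<longlonglongrightarrow> 0"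
proof -
  have mlim: "filterlim m at_top sequentially" and nlim: "filterlim n at_top sequentially"
    by (rule filterlim_at_top_mono[OF min_lim], simp)+
  have mr: "filterlim (\<lambda>k. real (m k)) at_top sequentially" and nr: "filterlim (\<lambda>k. real (n k)) at_top sequentially"
    using filterlim_compose[OF filterlim_real_sequentially mlim] filterlim_compose[OF filterlim_real_sequentially nlim] by auto
  have m1: "eventually (\<lambda>k. 1 \<le> m k) sequentially" and n1: "eventually (\<lambda>k. 1 \<le> n k) sequentially"
    using mlim nlim by (auto simp: filterlim_at_top)
  have L2: "(L k)\<^sup>2 = 1 + 8 * c * (ln (real (m k)) + ln (real (n k)))" "0 < L k" if "1 \<le> m k" "1 \<le> n k" for k
  proof -
    have "0 \<le> 8 * c * (ln (real (m k)) + ln (real (n k)))" using that c by (intro mult_nonneg_nonneg add_nonneg_nonneg) auto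
    then show "(L k)\<^sup>2 = 1 + 8 * c * (ln (real (m k)) + ln (real (n k)))" "0 < L k" by (simp_all add: L_def)
  qed
  have ln_ratio1: "(\<lambda>k. ln (real (m k)) / sqrt (real (n k))) \<longlonglongrightarrow> 0"
    and ln_ratio2: "(\<lambda>k. ln (real (n k)) / sqrt (real (m k))) \<longlonglongrightarrow> 0"
    using smalloD_tendsto[OF rate1] smalloD_tendsto[OF rate2] .
  have ln_self: "((\<lambda>x::real. ln x / sqrt x) \<longlongrightarrow> 0) at_top" by real_asymp
  have inv_sqrt: "((\<lambda>x::real. 1 / sqrt x) \<longlongrightarrow> 0) at_top" by real_asymp
  note ln_m = filterlim_compose[OF ln_self mr] and ln_n = filterlim_compose[OF ln_self nr]
  note inv_m = filterlim_compose[OF inv_sqrt mr] and inv_n = filterlim_compose[OF inv_sqrt nr]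
  have t1: "(\<lambda>k. real (m k) * real (n k) * (2 * exp (- ((L k)\<^sup>2 / (4 * c))))) \<longlonglongrightarrow> 0"
  proof (rule tendsto_sandwich[OF _ _ tendsto_const])
    show "(\<lambda>k. 2 * (1 / sqrt (real (m k)))\<^sup>2) \<longlonglongrightarrow> 0"
      by (rule tendsto_mult_right_zero, rule tendsto_null_power[OF inv_m]) simp
    show "eventually (\<lambda>k. real (m k) * real (n k) * (2 * exp (- ((L k)\<^sup>2 / (4 * c)))) \<le> 2 * (1 / sqrt (real (m k)))\<^sup>2) sequentially"
      using m1 n1
    proof eventually_elim
      case (elim k)
      have "- ((L k)\<^sup>2 / (4 * c)) \<le> - 2 * (ln (real (m k)) + ln (real (n k)))"
        using c by (simp add: L2[OF elim] field_simps)
      also have "\<dots> = - ln ((real (m k) * real (n k))\<^sup>2)"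
        using elim by (simp add: ln_mult ln_realpow)
      finally have "exp (- ((L k)\<^sup>2 / (4 * c))) \<le> exp (- ln ((real (m k) * real (n k))\<^sup>2))" by simp
      also have "\<dots> = 1 / (real (m k) * real (n k))\<^sup>2"
        using elim by (simp add: exp_minus inverse_eq_divide)
      finally have "real (m k) * real (n k) * (2 * exp (- ((L k)\<^sup>2 / (4 * c))))
          \<le> real (m k) * real (n k) * (2 * (1 / (real (m k) * real (n k))\<^sup>2))"
        by (intro mult_left_mono) auto
      also have "\<dots> = 2 / (real (m k) * real (n k))" using elim by (simp add: power2_eq_square)
      also have "\<dots> \<le> 2 / (real (m k) * 1)" using elim by (intro divide_left_mono mult_left_mono) auto
      finally show ?case by (simp add: power_divide)
    qed
  qed auto
  have Lm: "(\<lambda>k. (1 + 8 * c * (ln (real (m k)) + ln (real (n k)))) / sqrt (real (m k))) \<longlonglongrightarrow> 0"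
    using tendsto_add_zero[OF inv_m tendsto_mult_right_zero[OF tendsto_add_zero[OF ln_m ln_ratio2], of "8 * c"]]
    by (simp add: add_divide_distrib distrib_left)
  have Ln: "(\<lambda>k. (1 + 8 * c * (ln (real (m k)) + ln (real (n k)))) / sqrt (real (n k))) \<longlonglongrightarrow> 0"
    using tendsto_add_zero[OF inv_n tendsto_mult_right_zero[OF tendsto_add_zero[OF ln_ratio1 ln_n], of "8 * c"]]
    by (simp add: add_divide_distrib distrib_left)
  have "(\<lambda>k. \<kappa> / \<epsilon> ^ 4 * (((1 + 8 * c * (ln (real (m k)) + ln (real (n k)))) / sqrt (real (m k)))\<^sup>2
     + ((1 + 8 * c * (ln (real (m k)) + ln (real (n k)))) / sqrt (real (n k)))\<^sup>2)) \<longlonglongrightarrow> 0"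
    by (intro tendsto_mult_right_zero tendsto_add_zero tendsto_null_power Lm Ln) simp_all
  then have t2: "(\<lambda>k. \<kappa> * (real (m k) * (real (n k))\<^sup>2 + (real (m k))\<^sup>2 * real (n k)) / (\<epsilon> / L k * (sqrt (real (m k)) * sqrt (real (n k)))) ^ 4) \<longlonglongrightarrow> 0"
  proof (rule Lim_transform_eventually)
    show "eventually (\<lambda>k. \<kappa> / \<epsilon> ^ 4 * (((1 + 8 * c * (ln (real (m k)) + ln (real (n k)))) / sqrt (real (m k)))\<^sup>2
     + ((1 + 8 * c * (ln (real (m k)) + ln (real (n k)))) / sqrt (real (n k)))\<^sup>2) =
     \<kappa> * (real (m k) * (real (n k))\<^sup>2 + (real (m k))\<^sup>2 * real (n k)) / (\<epsilon> / L k * (sqrt (real (m k)) * sqrt (real (n k)))) ^ 4) sequentially"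
      using m1 n1
    proof eventually_elim
      case (elim k)
      have p4: "(\<epsilon> / L k * (sqrt (real (m k)) * sqrt (real (n k)))) ^ 4
          = \<epsilon> ^ 4 / ((L k)\<^sup>2)\<^sup>2 * ((real (m k))\<^sup>2 * (real (n k))\<^sup>2)"
      proof -
        have "sqrt (real x) ^ 4 = (real x)\<^sup>2" for x
          using power_mult[of "sqrt (real x)" 2 2] by simp
        then show ?thesis by (simp add: power_mult_distrib power_divide flip: power_mult)
      qed
      have frac: "\<kappa> / e * (l / u + l / v) = \<kappa> * (u * v\<^sup>2 + u\<^sup>2 * v) / (e / l * (u\<^sup>2 * v\<^sup>2))"
        if "0 < e" "0 < l" "0 < u" "0 < v" for e l u v :: real
        using that by (simp add: field_simps power2_eq_square)
      have "0 < ((L k)\<^sup>2)\<^sup>2" using L2(2)[OF elim] by simp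
      from frac[OF _ this, of "\<epsilon> ^ 4" "real (m k)" "real (n k)"]
      show ?case unfolding p4 L2(1)[OF elim, symmetric]
        using elim \<epsilon> by (simp add: power_divide)
    qed
  qed
  define q where "q = \<epsilon>\<^sup>2 / (4 * c)"
  have q: "0 < q" using c \<epsilon> by (simp add: q_def)
  have decay: "((\<lambda>x::real. exp (sqrt x - q * x)) \<longlongrightarrow> 0) at_top" using q by real_asymp
  \<comment> \<open>The rate gives u \<le> exp(sqrt v) eventually, so the u terms of the union bound
    lose against exp(- q v).\<close>
  have tail: "(\<lambda>k. real (u k) * real p * (2 * exp (- (\<epsilon>\<^sup>2 * real (v k) / (4 * c))))) \<longlonglongrightarrow> 0"
    if u: "eventually (\<lambda>k. 1 \<le> u k) sequentially" and v: "filterlim (\<lambda>k. real (v k)) at_top sequentially"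
      and ratio: "(\<lambda>k. ln (real (u k)) / sqrt (real (v k))) \<longlonglongrightarrow> 0"
    for u v :: "nat \<Rightarrow> nat" and p :: nat
  proof (rule tendsto_sandwich[OF _ _ tendsto_const])
    show "(\<lambda>k. 2 * real p * exp (sqrt (real (v k)) - q * real (v k))) \<longlonglongrightarrow> 0"
      by (rule tendsto_mult_right_zero[OF filterlim_compose[OF decay v]])
    have "eventually (\<lambda>k. ln (real (u k)) / sqrt (real (v k)) < 1) sequentially"
      using order_tendstoD(2)[OF ratio, of 1] by simp
    moreover have "eventually (\<lambda>k. 0 < real (v k)) sequentially"
      using v unfolding filterlim_at_top_dense by blast
    ultimately show "eventually (\<lambda>k. real (u k) * real p * (2 * exp (- (\<epsilon>\<^sup>2 * real (v k) / (4 * c))))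
        \<le> 2 * real p * exp (sqrt (real (v k)) - q * real (v k))) sequentially"
      using u
    proof eventually_elim
      case (elim k)
      then have "ln (real (u k)) \<le> sqrt (real (v k))" by (simp add: pos_divide_less_eq)
      then have "exp (ln (real (u k))) \<le> exp (sqrt (real (v k)))" by simp
      then have "real (u k) \<le> exp (sqrt (real (v k)))" using elim by simp
      then have "real (u k) * exp (- (q * real (v k))) \<le> exp (sqrt (real (v k))) * exp (- (q * real (v k)))"
        by (intro mult_right_mono) auto
      also have "\<dots> = exp (sqrt (real (v k)) - q * real (v k))" by (simp flip: exp_add)
      finally have "2 * real p * (real (u k) * exp (- (q * real (v k))))
          \<le> 2 * real p * exp (sqrt (real (v k)) - q * real (v k))"
        by (intro mult_left_mono) auto
      then show ?case by (simp add: q_def mult_ac)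
    qed
  qed auto
  show ?thesis
    using tendsto_add[OF tendsto_add[OF tendsto_add[OF t1 t2] tail[OF m1 nr ln_ratio1, of p2]]
        tail[OF n1 mr ln_ratio2, of p1]] by simp
qed

theorem theorem12:
  fixes p1 p2 r :: nat
    and Sigma0 W1 W2 :: "nat \<Rightarrow> nat \<Rightarrow> real" and d :: "nat \<Rightarrow> real" and delta :: real
    and m n :: "nat \<Rightarrow> nat"
    and tau0 gamma0 :: "nat \<Rightarrow> nat \<Rightarrow> nat" and w pi :: "nat \<Rightarrow> real"
    and M :: "'a measure" and E :: "nat \<Rightarrow> nat \<Rightarrow> nat \<Rightarrow> 'a \<Rightarrow> real"
    and \<mu> :: "real measure" and \<sigma> :: real
  assumes svd_W1: "orthonormal_cols p1 r W1"
    and svd_W2: "orthonormal_cols p2 r W2"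
    and svd_d_pos: "\<forall>k<r. 0 < d k"
    and svd_d_mono: "\<forall>k1 k2. k1 \<le> k2 \<longrightarrow> k2 < r \<longrightarrow> d k2 \<le> d k1"
    and svd_eq: "\<forall>s<p1. \<forall>t<p2. Sigma0 s t = (\<Sum>k<r. W1 s k * d k * W2 t k)"
    and delta_pos: "delta > 0"
    and sep1: "\<forall>s1<p1. \<forall>s2<p1. s1 \<noteq> s2 \<longrightarrow>
        sqrt (\<Sum>k<r. (W1 s1 k * sqrt (d k) - W1 s2 k * sqrt (d k))\<^sup>2) \<ge> delta"
    and sep2: "\<forall>t1<p2. \<forall>t2<p2. t1 \<noteq> t2 \<longrightarrow>
        sqrt (\<Sum>k<r. (W2 t1 k * sqrt (d k) - W2 t2 k * sqrt (d k))\<^sup>2) \<ge> delta"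
    and tau0_range: "\<forall>k. \<forall>i<m k. tau0 k i < p1"
    and gamma0_range: "\<forall>k. \<forall>j<n k. gamma0 k j < p2"
    and w_lim: "\<forall>s<p1. (\<lambda>k. real (card {i. i < m k \<and> tau0 k i = s}) / real (m k)) \<longlonglongrightarrow> w s"
    and w_pos: "\<forall>s<p1. w s > 0"
    and pi_lim: "\<forall>t<p2. (\<lambda>k. real (card {j. j < n k \<and> gamma0 k j = t}) / real (n k)) \<longlonglongrightarrow> pi t"
    and pi_pos: "\<forall>t<p2. pi t > 0"
    and prob: "prob_space M"
    and indep: "\<forall>k. prob_space.indep_vars M (\<lambda>_. borel) (\<lambda>(i, j). E k i j) ({..<m k} \<times> {..<n k})"
    and ident: "\<forall>k i j. i < m k \<longrightarrow> j < n k \<longrightarrow> distr M borel (E k i j) = \<mu>"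
    and mean0: "integrable \<mu> (\<lambda>x. x) \<and> (\<integral>x. x \<partial>\<mu>) = 0"
    and var: "integrable \<mu> (\<lambda>x. x\<^sup>2) \<and> (\<integral>x. x\<^sup>2 \<partial>\<mu>) = \<sigma>\<^sup>2"
    and sigma_pos: "\<sigma> > 0"
    and subg: "subgaussian \<mu>"
    and min_lim: "filterlim (\<lambda>k. min (m k) (n k)) at_top sequentially"
    and rate1: "(\<lambda>k. ln (real (m k))) \<in> o(\<lambda>k. sqrt (real (n k)))"
    and rate2: "(\<lambda>k. ln (real (n k))) \<in> o(\<lambda>k. sqrt (real (m k)))"
  shows "\<exists>A. (\<forall>k. A k \<in> sets M \<and>
            A k \<subseteq> {x \<in> space M.
              \<forall>Uh Vh CU CV tauh gammah.
                leading_sv (m k) (n k) r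
                   (\<lambda>i j. Sigma0 (tau0 k i) (gamma0 k j) + E k i j x) Uh Vh \<and>
                kmeans_sol (m k) r p1 Uh CU \<and> kmeans_sol (n k) r p2 Vh CV \<and>
                labeling (m k) r p1 CU tauh \<and> labeling (n k) r p2 CV gammah \<longrightarrow>
                (\<exists>\<omega>. \<omega> permutes {..<p1} \<and> hamming (m k) tauh (\<omega> \<circ> tau0 k) = 0) \<and>
                (\<exists>\<iota>. \<iota> permutes {..<p2} \<and> hamming (n k) gammah (\<iota> \<circ> gamma0 k) = 0)})
          \<and> (\<lambda>k. measure M (A k)) \<longlonglongrightarrow> 1"
proof -
  interpret prob_space M by (rule prob)
  obtain c where c: "0 < c" and sub: "\<And>t. integrable \<mu> (\<lambda>x. exp (t * x))"
    "\<And>t. (\<integral>x. exp (t * x) \<partial>\<mu>) \<le> exp (c * t\<^sup>2)"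
    using subg unfolding subgaussian_def by blast
  obtain e1 e2 where e: "0 < e1" "\<forall>s<p1. e1 \<le> w s" "0 < e2" "\<forall>t<p2. e2 \<le> pi t"
    using finite_positive_lower_bound[OF w_pos] finite_positive_lower_bound[OF pi_pos] by blast
  \<comment> \<open>Strictly below every limiting proportion, so that the actual cluster proportions
    eventually exceed it.\<close>
  define \<alpha> where "\<alpha> = min e1 e2 / 2"
  have \<alpha>: "0 < \<alpha>" "\<And>s. s < p1 \<Longrightarrow> \<alpha> < w s" "\<And>t. t < p2 \<Longrightarrow> \<alpha> < pi t"
  proof -
    show "0 < \<alpha>" using e by (simp add: \<alpha>_def)
    show "\<alpha> < w s" if "s < p1" for s
    proof -
      have "e1 \<le> w s" using e that by blast
      then show ?thesis using e(1,3) unfolding \<alpha>_def by linarith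
    qed
    show "\<alpha> < pi t" if "t < p2" for t
    proof -
      have "e2 \<le> pi t" using e that by blast
      then show ?thesis using e(1,3) unfolding \<alpha>_def by linarith
    qed
  qed
  obtain dm where dm: "0 < dm" "\<And>k. k < r \<Longrightarrow> dm \<le> d k"
    using finite_positive_lower_bound[OF svd_d_pos] by blast
  define S where "S = (\<Sum>(s, t)\<in>{..<p1} \<times> {..<p2}. \<bar>Sigma0 s t\<bar>)"
  have S: "0 \<le> S" "\<And>s t. s < p1 \<Longrightarrow> t < p2 \<Longrightarrow> \<bar>Sigma0 s t\<bar> \<le> S"
  proof -
    show "0 \<le> S" unfolding S_def by (intro sum_nonneg) auto
    show "\<bar>Sigma0 s t\<bar> \<le> S" if "s < p1" "t < p2" for s t
      unfolding S_def using member_le_sum[of "(s, t)" "{..<p1} \<times> {..<p2}" "\<lambda>(s, t). \<bar>Sigma0 s t\<bar>"] that by auto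
  qed
  \<comment> \<open>The least positive K with K^2 \<alpha> \<ge> 1.\<close>
  define K where "K = 1 / sqrt \<alpha>"
  have K: "0 < K" "1 \<le> K\<^sup>2 * \<alpha>" using \<alpha> by (auto simp: K_def power_divide)
  \<comment> \<open>One \<epsilon> serves rows and columns; the last two conditions differ only in
    p2 and p1.\<close>
  obtain \<epsilon> where \<epsilon>: "0 < \<epsilon>" "\<epsilon> \<le> min 1 (\<alpha> * dm / 2)"
    "\<epsilon> * (4 * S * sqrt (2 / \<alpha>)) < \<alpha> * dm * delta\<^sup>2 / 2"
    "\<epsilon> * ((4 + 2 * K) * (real r * (S * real p2 + 1) / (\<alpha> * dm / 2)\<^sup>2))
        < \<alpha> * dm * delta\<^sup>2 / 2 / (sqrt (2 / \<alpha>) * (S + 1)) / (S + 1)"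
    "\<epsilon> * ((4 + 2 * K) * (real r * (S * real p1 + 1) / (\<alpha> * dm / 2)\<^sup>2))
        < \<alpha> * dm * delta\<^sup>2 / 2 / (sqrt (2 / \<alpha>) * (S + 1)) / (S + 1)"
  proof -
    have "0 \<le> 4 * S * sqrt (2 / \<alpha>)" "0 < \<alpha> * dm * delta\<^sup>2 / 2"
      "0 \<le> (4 + 2 * K) * (real r * (S * real p2 + 1) / (\<alpha> * dm / 2)\<^sup>2)"
      "0 < \<alpha> * dm * delta\<^sup>2 / 2 / (sqrt (2 / \<alpha>) * (S + 1)) / (S + 1)"
      "0 \<le> (4 + 2 * K) * (real r * (S * real p1 + 1) / (\<alpha> * dm / 2)\<^sup>2)"
      "0 < min 1 (\<alpha> * dm / 2)"
      using S(1) \<alpha>(1) dm(1) delta_pos K(1) by auto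
    from small_multiplier4[OF this(1,2,3,4,5,4,6)] show ?thesis using that by blast
  qed
  define L where "L = (\<lambda>k. sqrt (1 + 8 * c * (ln (real (m k)) + ln (real (n k)))))"
  \<comment> \<open>The largest value for which \<open>B k * L k\<close> stays within \<epsilon>
    sqrt(m n), as \<open>clusters_recovered\<close> requires.\<close>
  define B where "B = (\<lambda>k. \<epsilon> / L k * (sqrt (real (m k)) * sqrt (real (n k))))"
  define good where "good = (\<lambda>k. r < min (m k) (n k) \<and> 1 \<le> m k \<and> 1 \<le> n k \<and>
    (\<forall>s\<in>{..<p1}. \<alpha> * real (m k) \<le> cluster_size (m k) (tau0 k) s) \<and>
    (\<forall>t\<in>{..<p2}. \<alpha> * real (n k) \<le> cluster_size (n k) (gamma0 k) t))"
  define T where "T = (\<lambda>k. {x \<in> space M.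
     tame_noise (m k) (n k) p1 p2 (tau0 k) (gamma0 k) (L k) (B k ^ 4) \<epsilon> (\<lambda>i j. E k i j x)})"
  \<comment> \<open>Where k is not good the event is empty, which keeps measurability and the
    inclusion and does not affect the limit.\<close>
  define A where "A = (\<lambda>k. if good k then T k else {})"
  have L1: "1 \<le> L k" if "good k" for k
  proof -
    have "0 \<le> 8 * c * (ln (real (m k)) + ln (real (n k)))"
      using that c by (intro mult_nonneg_nonneg add_nonneg_nonneg) (auto simp: good_def)
    then show ?thesis by (simp add: L_def)
  qed
  have Bpos: "0 < B k" if "good k" for k
    using L1[OF that] that \<epsilon> by (auto simp: B_def good_def)
  have noise: "T k \<in> events" "1 - prob (T k) \<le> real (m k) * real (n k) * (2 * exp (- ((L k)\<^sup>2 / (4 * c))))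
      + (\<integral>x. x ^ 4 \<partial>\<mu>) * (real (m k) * (real (n k))\<^sup>2 + (real (m k))\<^sup>2 * real (n k)) / B k ^ 4
      + real (m k) * real p2 * (2 * exp (- (\<epsilon>\<^sup>2 * real (n k) / (4 * c))))
      + real (n k) * real p1 * (2 * exp (- (\<epsilon>\<^sup>2 * real (m k) / (4 * c))))" if k: "good k" for k
  proof -
    have ind: "indep_vars (\<lambda>_. borel) (\<lambda>(i, j). E k i j) ({..<m k} \<times> {..<n k})" using indep by blast
    have rv: "E k i j \<in> borel_measurable M" if "i < m k" "j < n k" for i j
      using ind that unfolding indep_vars_def2 by fastforce
    note mom = subgaussian_moments[OF rv ident[rule_format] conjunct1[OF mean0] conjunct2[OF mean0] sub]
    have pos: "0 < m k" "0 < n k" "0 \<le> L k" "0 < B k ^ 4" "0 \<le> \<epsilon>"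
      using k L1[OF k] Bpos[OF k] \<epsilon> by (auto simp: good_def)
    show "T k \<in> events" unfolding T_def
      by (rule tame_noise_prob(1)[OF ind mom(1) mom(2) mom(5) mom(6) c mom(3) mom(4) pos])
    show "1 - prob (T k) \<le> real (m k) * real (n k) * (2 * exp (- ((L k)\<^sup>2 / (4 * c))))
      + (\<integral>x. x ^ 4 \<partial>\<mu>) * (real (m k) * (real (n k))\<^sup>2 + (real (m k))\<^sup>2 * real (n k)) / B k ^ 4
      + real (m k) * real p2 * (2 * exp (- (\<epsilon>\<^sup>2 * real (n k) / (4 * c))))
      + real (n k) * real p1 * (2 * exp (- (\<epsilon>\<^sup>2 * real (m k) / (4 * c))))"
      unfolding T_def
      by (rule tame_noise_prob(2)[OF ind mom(1) mom(2) mom(5) mom(6) c mom(3) mom(4) pos])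
  qed
  have good_ev: "eventually good sequentially"
  proof -
    have "eventually (\<lambda>k. r + 1 \<le> min (m k) (n k)) sequentially"
      using min_lim by (simp add: filterlim_at_top)
    moreover have "eventually (\<lambda>k. \<forall>s\<in>{..<p1}. \<alpha> < cluster_size (m k) (tau0 k) s / real (m k)) sequentially"
      using w_lim \<alpha> by (intro eventually_ball_finite) (auto intro!: order_tendstoD(1))
    moreover have "eventually (\<lambda>k. \<forall>t\<in>{..<p2}. \<alpha> < cluster_size (n k) (gamma0 k) t / real (n k)) sequentially"
      using pi_lim \<alpha> by (intro eventually_ball_finite) (auto intro!: order_tendstoD(1))
    ultimately show ?thesis
    proof eventually_elim
      case (elim k)
      then have "0 < real (m k)" "0 < real (n k)" by auto
      then show ?case using elim unfolding good_def by (auto simp: pos_less_divide_eq less_imp_le)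
    qed
  qed
  have lim: "(\<lambda>k. prob (A k)) \<longlonglongrightarrow> 1"
  proof (rule tendsto_sandwich[OF _ _ _ tendsto_const])
    note tendsto_diff[OF tendsto_const[of 1] tame_noise_failure_tendsto_0[OF min_lim rate1 rate2 c \<epsilon>(1),
        of "\<integral>x. x ^ 4 \<partial>\<mu>" p2 p1]]
    then show "(\<lambda>k. 1 - (real (m k) * real (n k) * (2 * exp (- ((L k)\<^sup>2 / (4 * c))))
      + (\<integral>x. x ^ 4 \<partial>\<mu>) * (real (m k) * (real (n k))\<^sup>2 + (real (m k))\<^sup>2 * real (n k)) / B k ^ 4
      + real (m k) * real p2 * (2 * exp (- (\<epsilon>\<^sup>2 * real (n k) / (4 * c))))
      + real (n k) * real p1 * (2 * exp (- (\<epsilon>\<^sup>2 * real (m k) / (4 * c)))))) \<longlonglongrightarrow> 1"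
      unfolding L_def B_def by simp
    show "eventually (\<lambda>k. 1 - (real (m k) * real (n k) * (2 * exp (- ((L k)\<^sup>2 / (4 * c))))
      + (\<integral>x. x ^ 4 \<partial>\<mu>) * (real (m k) * (real (n k))\<^sup>2 + (real (m k))\<^sup>2 * real (n k)) / B k ^ 4
      + real (m k) * real p2 * (2 * exp (- (\<epsilon>\<^sup>2 * real (n k) / (4 * c))))
      + real (n k) * real p1 * (2 * exp (- (\<epsilon>\<^sup>2 * real (m k) / (4 * c))))) \<le> prob (A k)) sequentially"
      using good_ev by eventually_elim (use noise(2) in \<open>force simp: A_def\<close>)
  qed simp
  have recover: "(\<exists>\<omega>. \<omega> permutes {..<p1} \<and> hamming (m k) tauh (\<omega> \<circ> tau0 k) = 0) \<and>
     (\<exists>\<iota>. \<iota> permutes {..<p2} \<and> hamming (n k) gammah (\<iota> \<circ> gamma0 k) = 0)"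
    if k: "good k" and x: "x \<in> T k"
      and sv: "leading_sv (m k) (n k) r (\<lambda>i j. Sigma0 (tau0 k i) (gamma0 k j) + E k i j x) Uh Vh"
      and km: "kmeans_sol (m k) r p1 Uh CU" "kmeans_sol (n k) r p2 Vh CV"
      and lab: "labeling (m k) r p1 CU tauh" "labeling (n k) r p2 CV gammah"
    for k x Uh Vh CU CV tauh gammah
  proof -
    define F where "F = (\<lambda>i j. E k i j x)"
    have tame: "\<And>i j. i < m k \<Longrightarrow> j < n k \<Longrightarrow> \<bar>F i j\<bar> \<le> L k" "gram_norm2 (m k) (n k) F \<le> B k ^ 4"
      "\<And>i t. i < m k \<Longrightarrow> t < p2 \<Longrightarrow> \<bar>\<Sum>j | j < n k \<and> gamma0 k j = t. F i j\<bar> \<le> \<epsilon> * real (n k)"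
      "\<And>j s. j < n k \<Longrightarrow> s < p1 \<Longrightarrow> \<bar>\<Sum>i | i < m k \<and> tau0 k i = s. F i j\<bar> \<le> \<epsilon> * real (m k)"
      using x unfolding T_def tame_noise_def F_def by auto
    have op: "\<bar>bil (m k) (n k) u F v\<bar> \<le> B k * vnorm (m k) u * vnorm (n k) v" for u v
      by (rule bil_le_gram_norm2[OF less_imp_le[OF Bpos[OF k]] tame(2)])
    have op': "\<bar>bil (n k) (m k) v (\<lambda>j i. F i j) u\<bar> \<le> B k * vnorm (n k) v * vnorm (m k) u" for u v
      unfolding bil_transpose[of "n k" "m k" v F u] using op[of u v] by (simp only: mult_ac)
    obtain U s V where svd: "thin_svd (m k) (n k) (\<lambda>i j. Sigma0 (tau0 k i) (gamma0 k j) + F i j) U s V"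
      and UV: "\<And>i l. i < m k \<Longrightarrow> l < r \<Longrightarrow> Uh i l = U i l" "\<And>j l. j < n k \<Longrightarrow> l < r \<Longrightarrow> Vh j l = V j l"
      using sv unfolding leading_sv_def F_def by blast
    have size: "\<And>s. s < p1 \<Longrightarrow> \<alpha> * real (m k) \<le> cluster_size (m k) (tau0 k) s"
      "\<And>t. t < p2 \<Longrightarrow> \<alpha> * real (n k) \<le> cluster_size (n k) (gamma0 k) t"
      "r < min (m k) (n k)" "r < min (n k) (m k)"
      using k by (auto simp: good_def)
    have rng: "\<And>i. i < m k \<Longrightarrow> tau0 k i < p1" "\<And>j. j < n k \<Longrightarrow> gamma0 k j < p2"
      using tau0_range gamma0_range by auto
    have S0: "\<And>s t. s < p1 \<Longrightarrow> t < p2 \<Longrightarrow> Sigma0 s t = (\<Sum>k<r. W1 s k * d k * W2 t k)"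
      "\<And>t s. t < p2 \<Longrightarrow> s < p1 \<Longrightarrow> Sigma0 s t = (\<Sum>k<r. W2 t k * d k * W1 s k)"
      using svd_eq by (auto simp: mult_ac)
    interpret left: perturbed_biclustering "m k" "n k" p1 p2 r W1 W2 d Sigma0 "tau0 k" "gamma0 k" \<alpha> dm S F "B k" U V s
      by (rule perturbed_biclustering.intro[OF svd_W1 svd_W2 S0(1) dm S rng \<alpha>(1) size(1-3) op svd])
    \<comment> \<open>The same realisation read by columns: transposition exchanges U and V and
      keeps s and the operator norm bound.\<close>
    interpret right: perturbed_biclustering "n k" "m k" p2 p1 r W2 W1 d "\<lambda>t s. Sigma0 s t" "gamma0 k" "tau0 k" \<alpha> dm S
      "\<lambda>j i. F i j" "B k" V U s
      by (rule perturbed_biclustering.intro[OF svd_W2 svd_W1 S0(2) dm S(1) S(2) rng(2,1) \<alpha>(1)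
            size(2,1,4) op' thin_svd_transpose[OF svd]])
    have BL: "B k * L k \<le> \<epsilon> * (sqrt (real (m k)) * sqrt (real (n k)))"
      using L1[OF k] by (simp add: B_def)
    have Bq: "B k \<le> \<epsilon> * (sqrt (real (m k)) * sqrt (real (n k)))"
      using mult_left_mono[OF L1[OF k] less_imp_le[OF Bpos[OF k]]] BL by simp
    have e': "0 \<le> \<epsilon>" "\<epsilon> \<le> 1" "\<epsilon> \<le> \<alpha> * dm / 2" using \<epsilon> by auto
    have L0: "0 \<le> L k" using L1[OF k] by simp
    have 1: "\<exists>\<omega>. \<omega> permutes {..<p1} \<and> hamming (m k) tauh (\<omega> \<circ> tau0 k) = 0"
      by (rule left.clusters_recovered[OF km(1) lab(1) UV(1) delta_pos _ L0 tame(1) tame(3) Bq BL e'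
            less_imp_le[OF \<epsilon>(3)] K \<epsilon>(4)])
        (use sep1 in auto)
    have 2: "\<exists>\<omega>. \<omega> permutes {..<p2} \<and> hamming (n k) gammah (\<omega> \<circ> gamma0 k) = 0"
      by (rule right.clusters_recovered[OF km(2) lab(2) UV(2) delta_pos _ L0 tame(1) tame(4) _ _ e'
            less_imp_le[OF \<epsilon>(3)] K \<epsilon>(5)])
        (use sep2 Bq BL in \<open>auto simp: mult_ac\<close>)
    show ?thesis using 1 2 by blast
  qed
  have "A k \<in> events" for k using noise(1) by (simp add: A_def)
  moreover have "x \<in> T k \<Longrightarrow> x \<in> space M" for x k by (simp add: T_def)
  ultimately show ?thesis using lim recover by (intro exI[of _ A]) (auto simp: A_def split: if_splits)
qed

end
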